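(* Fix $r\in(0,\infty)$. For $\eta\in(0,1/2)$ let $v_w=(1+r^{-1})^{-1}$, $\lambda_e=\lambda_e(\eta)=\sqrt{2\log(\eta^{-1}(1-\eta))}$ and $\lambda_f=\lambda_f(\eta)=\sqrt{v_w}\,\lambda_e$. Then: (A) As $\eta\to0$, $\displaystyle \beta(\eta,r)=\frac{1}{2r}\,\eta\,\lambda_f^2\,(1+o(1)).$ (B) The two-point prior $\pi[\eta,\lambda_f]=(1-\eta)\delta_0+\eta\,\delta_{\lambda_f}\in\mathfrak{m}(\eta)$ is asymptotically least favorable: $B(\pi[\eta,\lambda_f])=\beta(\eta,r)(1+o(1))$ as $\eta\to0$. (C) The threshold estimator $\hat p_{T,\mathrm{CL}}$ with threshold $\lambda_e$ built on the cluster prior $\pi_{\mathrm{CL}}[\eta,r]$ (defined in the context) is asymptotically minimax: $\sup_{\pi\in\mathfrak{m}(\eta)}B(\pi,\hat p_{T,\mathrm{CL}})=\beta(\eta,r)(1+o(1))$ as $\eta\to0$.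
   Context: Univariate model: given $\theta\in\mathbb{R}$, the past observation $X\sim N(\theta,1)$ and the future observation $Y\sim N(\theta,r)$ are independent; $r>0$ is known and fixed. Let $\phi(\cdot|\theta,v)$ be the $N(\theta,v)$ density. A predictive density estimator is a measurable $\hat p(y|x)$ such that $\hat p(\cdot|x)$ is a probability density on $\mathbb{R}$ for each $x$. Its Kullback--Leibler loss is $L(\theta,\hat p(\cdot|x))=\int\phi(y|\theta,r)\log\frac{\phi(y|\theta,r)}{\hat p(y|x)}\,dy$ and its risk is $\rho(\theta,\hat p)=\int L(\theta,\hat p(\cdot|x))\,\phi(x|\theta,1)\,dx$. For a probability measure $\pi$ on $\mathbb{R}$, $B(\pi,\hat p)=\int\rho(\theta,\hat p)\,\pi(d\theta)$ and $B(\pi)=\inf_{\hat p}B(\pi,\hat p)$. The class of sparse priors is $\mathfrak{m}(\eta)=\{\pi \text{ probability measure on }\mathbb{R}:\pi(\theta\ne0)\le\eta\}$, and the minimax risk is $\beta(\eta,r)=\inf_{\hat p}\sup_{\pi\in\mathfrak{m}(\eta)}B(\pi,\hat p)$. Infima are over all predictive density estimators. Threshold estimator with cluster prior: for small $\eta$, let $a=\sqrt{2\log\lambda_f}$, let $\mu_\eta$ be the positive root $\mu$ of $\mu^2+2a\mu=\lambda_e^2$, and $\nu_\eta=\sqrt{v_w}\,\mu_\eta$. Put $\mu_1=\nu_\eta$, $\mu_{k+1}=(1+2r)^k\nu_\eta$ for $k\ge1$, $K=\max\{k:\mu_k\le\lambda_e+a\}$, and $$\pi_{\mathrm{CL}}[\eta,r]=(1-\eta)\delta_0+\frac{\eta}{2K}\sum_{k=1}^K(\delta_{\mu_k}+\delta_{-\mu_k}),$$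 $\delta_\mu$ being the unit point mass at $\mu$. The Bayes predictive density of a prior $\pi$ is $\hat p_\pi(y|x)=\int\phi(y|\theta,r)\,\pi(d\theta|x)$, with $\pi(d\theta|x)$ the posterior given $X=x$. Let $\hat p_U(\cdot|x)$ be the $N(x,1+r)$ density. Then $\hat p_{T,\mathrm{CL}}(y|x)=\hat p_{\pi_{\mathrm{CL}}[\eta,r]}(y|x)$ if $|x|\le\lambda_e$, and $\hat p_{T,\mathrm{CL}}(y|x)=\hat p_U(y|x)$ if $|x|>\lambda_e$. *)

theory Defs
  imports "HOL-Probability.Probability" "HOL-Library.Landau_Symbols"
begin

text \<open>
  Losses and risks may be infinite, so they are \<^typ>\<open>ereal\<close>-valued and use the Lebesgue integral
  in the extended sense (positive part minus negative part); the Bochner integral would silently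
  return \<^term>\<open>0::real\<close> for a divergent Kullback--Leibler loss.
\<close>

definition ext_integral :: "'a measure \<Rightarrow> ('a \<Rightarrow> ereal) \<Rightarrow> ereal" where
  "ext_integral M f =
     enn2ereal (\<integral>\<^sup>+ x. e2ennreal (f x) \<partial>M) - enn2ereal (\<integral>\<^sup>+ x. e2ennreal (- f x) \<partial>M)"

lemma ext_integral_nonneg_eq:
  assumes "\<And>x. 0 \<le> f x"
  shows "ext_integral M f = enn2ereal (\<integral>\<^sup>+ x. e2ennreal (f x) \<partial>M)"
proof -
  have "e2ennreal (- f x) = 0" for x
    using assms[of x] by (intro e2ennreal_neg) (simp add: ereal_uminus_le_reorder)
  then show ?thesis
    by (simp add: ext_integral_def zero_ennreal.rep_eq)
qed

lemma ext_integral_ereal: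
  assumes "integrable M f"
  shows "ext_integral M (\<lambda>x. ereal (f x)) = ereal (integral\<^sup>L M f)"
proof -
  have fin: "(\<integral>\<^sup>+ x. ennreal (f x) \<partial>M) \<noteq> \<infinity>" "(\<integral>\<^sup>+ x. ennreal (- f x) \<partial>M) \<noteq> \<infinity>"
    using assms unfolding real_integrable_def by auto
  obtain a b where
    ab: "0 \<le> a" "(\<integral>\<^sup>+ x. ennreal (f x) \<partial>M) = ennreal a"
        "0 \<le> b" "(\<integral>\<^sup>+ x. ennreal (- f x) \<partial>M) = ennreal b"
    using fin by (metis ennreal_cases infinity_ennreal_def)
  have "integral\<^sup>L M f = a - b"
    using real_lebesgue_integral_def[OF assms] ab by simp
  then show ?thesis
    using ab by (simp add: ext_integral_def e2ennreal_ereal enn2ereal_ennreal)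
qed

definition gauss :: "real \<Rightarrow> real \<Rightarrow> real \<Rightarrow> real" where
  "gauss \<theta> v y = normal_density \<theta> (sqrt v) y"

text \<open>An estimator is written \<open>p x y\<close> for \<open>p(y|x)\<close>.\<close>

definition pred_estimators :: "(real \<Rightarrow> real \<Rightarrow> real) set" where
  "pred_estimators =
     {p. case_prod p \<in> borel_measurable (borel \<Otimes>\<^sub>M borel) \<and>
         (\<forall>x y. 0 \<le> p x y) \<and>
         (\<forall>x. (\<integral>\<^sup>+ y. ennreal (p x y) \<partial>lborel) = 1)}"

text \<open>
  The integrand of the Kullback--Leibler divergence for \<open>a > 0\<close>, \<open>b \<ge> 0\<close>; in HOL
  \<open>ln (a / 0) = 0\<close>, so the value \<open>\<infinity>\<close> at \<open>b = 0\<close> has to be given explicitly.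
\<close>

definition kl_term :: "real \<Rightarrow> real \<Rightarrow> ereal" where
  "kl_term a b = (if b = 0 then \<infinity> else ereal (a * ln (a / b)))"

definition kl_loss :: "real \<Rightarrow> real \<Rightarrow> (real \<Rightarrow> real) \<Rightarrow> ereal" where
  "kl_loss r \<theta> q = ext_integral lborel (\<lambda>y. kl_term (gauss \<theta> r y) (q y))"

definition risk :: "real \<Rightarrow> real \<Rightarrow> (real \<Rightarrow> real \<Rightarrow> real) \<Rightarrow> ereal" where
  "risk r \<theta> p = ext_integral lborel (\<lambda>x. kl_loss r \<theta> (p x) * ereal (gauss \<theta> 1 x))"

definition int_risk :: "real \<Rightarrow> real measure \<Rightarrow> (real \<Rightarrow> real \<Rightarrow> real) \<Rightarrow> ereal" where
  "int_risk r \<pi> p = ext_integral \<pi> (\<lambda>\<theta>. risk r \<theta> p)"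

definition bayes_risk :: "real \<Rightarrow> real measure \<Rightarrow> ereal" where
  "bayes_risk r \<pi> = (INF p\<in>pred_estimators. int_risk r \<pi> p)"

definition sparse_priors :: "real \<Rightarrow> real measure set" where
  "sparse_priors \<eta> =
     {\<pi>. prob_space \<pi> \<and> sets \<pi> = sets borel \<and> measure \<pi> {\<theta>. \<theta> \<noteq> 0} \<le> \<eta>}"

definition minimax_risk :: "real \<Rightarrow> real \<Rightarrow> ereal" where
  "minimax_risk \<eta> r = (INF p\<in>pred_estimators. SUP \<pi>\<in>sparse_priors \<eta>. int_risk r \<pi> p)"

definition v_w :: "real \<Rightarrow> real" where
  "v_w r = inverse (1 + inverse r)"

definition lambda_e :: "real \<Rightarrow> real" where
  "lambda_e \<eta> = sqrt (2 * ln (inverse \<eta> * (1 - \<eta>)))"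

definition lambda_f :: "real \<Rightarrow> real \<Rightarrow> real" where
  "lambda_f r \<eta> = sqrt (v_w r) * lambda_e \<eta>"

definition two_point_prior :: "real \<Rightarrow> real \<Rightarrow> real measure" where
  "two_point_prior \<eta> t = measure_of UNIV (sets borel)
     (\<lambda>A. ennreal (1 - \<eta>) * emeasure (return borel 0) A
         + ennreal \<eta> * emeasure (return borel t) A)"

text \<open>
  The quantities below have their intended meaning only for small \<open>\<eta>\<close>
  (so that \<open>lambda_f r \<eta> \<ge> 1\<close>), which is all that matters for the limit \<open>\<eta> \<rightarrow> 0\<close>.
\<close>

definition cl_a :: "real \<Rightarrow> real \<Rightarrow> real" where
  "cl_a r \<eta> = sqrt (2 * ln (lambda_f r \<eta>))"

definition cl_mu :: "real \<Rightarrow> real \<Rightarrow> real" where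
  "cl_mu r \<eta> = (THE \<mu>. 0 < \<mu> \<and> \<mu>\<^sup>2 + 2 * cl_a r \<eta> * \<mu> = (lambda_e \<eta>)\<^sup>2)"

definition cl_nu :: "real \<Rightarrow> real \<Rightarrow> real" where
  "cl_nu r \<eta> = sqrt (v_w r) * cl_mu r \<eta>"

text \<open>Support points are indexed from \<open>k = 1\<close>.\<close>

definition cl_point :: "real \<Rightarrow> real \<Rightarrow> nat \<Rightarrow> real" where
  "cl_point r \<eta> k = (1 + 2 * r) ^ (k - 1) * cl_nu r \<eta>"

definition cl_K :: "real \<Rightarrow> real \<Rightarrow> nat" where
  "cl_K r \<eta> = Max {k. 1 \<le> k \<and> cl_point r \<eta> k \<le> lambda_e \<eta> + cl_a r \<eta>}"

definition cluster_prior :: "real \<Rightarrow> real \<Rightarrow> real measure" where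
  "cluster_prior r \<eta> = measure_of UNIV (sets borel)
     (\<lambda>A. ennreal (1 - \<eta>) * emeasure (return borel 0) A
         + ennreal (\<eta> / (2 * real (cl_K r \<eta>))) *
           (\<Sum>k = 1..cl_K r \<eta>. emeasure (return borel (cl_point r \<eta> k)) A
                              + emeasure (return borel (- cl_point r \<eta> k)) A))"

text \<open>The set functions above are measures, so \<^const>\<open>measure_of\<close> does not collapse.\<close>

lemma countably_additive_add:
  assumes "countably_additive M f" "countably_additive M g"
  shows "countably_additive M (\<lambda>A. f A + g A :: ennreal)"
  using assms by (auto simp: countably_additive_def suminf_add[symmetric])

lemma countably_additive_cmult:
  assumes "countably_additive M f"
  shows "countably_additive M (\<lambda>A. c * f A :: ennreal)"
  using assms by (auto simp: countably_additive_def)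

lemma countably_additive_sum:
  assumes "\<And>i. i \<in> I \<Longrightarrow> countably_additive M (f i)"
  shows "countably_additive M (\<lambda>A. \<Sum>i\<in>I. f i A :: ennreal)"
  using assms
proof (induction I rule: infinite_finite_induct)
  case (insert i I)
  then show ?case
    using countably_additive_add[of M "f i" "\<lambda>A. \<Sum>i\<in>I. f i A"] by simp
qed (auto simp: countably_additive_def)

lemma countably_additive_return:
  "countably_additive (sets borel) (emeasure (return borel (x :: real)))"
  using emeasure_countably_additive[of "return borel x"] by simp

lemma emeasure_two_point_prior:
  assumes "A \<in> sets borel"
  shows "emeasure (two_point_prior \<eta> t) A =
     ennreal (1 - \<eta>) * emeasure (return borel 0) A + ennreal \<eta> * emeasure (return borel t) A"
  using assms unfolding two_point_prior_def
  by (intro emeasure_measure_of_sigma)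
     (auto simp: positive_def sets.sigma_algebra_axioms[of borel, simplified]
       intro!: countably_additive_add countably_additive_cmult countably_additive_return)

lemma emeasure_cluster_prior:
  assumes "A \<in> sets borel"
  shows "emeasure (cluster_prior r \<eta>) A =
     ennreal (1 - \<eta>) * emeasure (return borel 0) A
       + ennreal (\<eta> / (2 * real (cl_K r \<eta>))) *
         (\<Sum>k = 1..cl_K r \<eta>. emeasure (return borel (cl_point r \<eta> k)) A
                            + emeasure (return borel (- cl_point r \<eta> k)) A)"
  using assms unfolding cluster_prior_def
  by (intro emeasure_measure_of_sigma)
     (auto simp: positive_def sets.sigma_algebra_axioms[of borel, simplified]
       intro!: countably_additive_add countably_additive_cmult countably_additive_sum
         countably_additive_return)

definition posterior :: "real measure \<Rightarrow> real \<Rightarrow> real measure" where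
  "posterior \<pi> x =
     density \<pi> (\<lambda>\<theta>. ennreal (gauss \<theta> 1 x / (\<integral>\<theta>'. gauss \<theta>' 1 x \<partial>\<pi>)))"

definition bayes_pred :: "real \<Rightarrow> real measure \<Rightarrow> real \<Rightarrow> real \<Rightarrow> real" where
  "bayes_pred r \<pi> x y = (\<integral>\<theta>. gauss \<theta> r y \<partial>posterior \<pi> x)"

definition p_U :: "real \<Rightarrow> real \<Rightarrow> real \<Rightarrow> real" where
  "p_U r x y = gauss x (1 + r) y"

definition p_TCL :: "real \<Rightarrow> real \<Rightarrow> real \<Rightarrow> real \<Rightarrow> real" where
  "p_TCL r \<eta> x y =
     (if \<bar>x\<bar> \<le> lambda_e \<eta> then bayes_pred r (cluster_prior r \<eta>) x y else p_U r x y)"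

text \<open>\<open>f \<eta> = g \<eta> (1 + o(1))\<close> as \<open>\<eta> \<rightarrow> 0\<close> from the right.\<close>

definition asymp_eq_at_0 :: "(real \<Rightarrow> ereal) \<Rightarrow> (real \<Rightarrow> ereal) \<Rightarrow> bool" where
  "asymp_eq_at_0 f g \<longleftrightarrow>
     (\<exists>\<delta> :: real \<Rightarrow> real. \<delta> \<in> o[at_right 0](\<lambda>_. 1) \<and>
        (\<forall>\<^sub>F \<eta> in at_right 0. f \<eta> = g \<eta> * ereal (1 + \<delta> \<eta>)))"

end

theory Submission
  imports Defs "HOL-Real_Asymp.Real_Asymp"
begin

text \<open>
  Write \<open>L = \<lambda>\<^sub>e\<close>, so that \<open>exp (- L\<^sup>2 / 2)\<close> is the prior odds \<open>\<eta> / (1 - \<eta>)\<close> of a nonzero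
  parameter. With \<open>v\<^sub>w = r / (1 + r)\<close> the claimed rate is \<open>\<eta> L\<^sup>2 / (2 (1 + r))\<close>. Everything follows
  from the chain

    \<open>(1 - e) rate \<le> B(\<pi>[\<eta>, \<lambda>\<^sub>f]) \<le> \<beta>(\<eta>, r) \<le> sup B(\<pi>, p\<^sub>T\<^sub>C\<^sub>L) \<le> (1 + e) rate\<close>,

  valid for each \<open>e > 0\<close> and all small \<open>\<eta>\<close>. Its two inner inequalities are immediate from the definitions.

  Lower bound (\<open>bayes_risk_two_point_ge\<close>). Let \<open>t = \<lambda>\<^sub>f\<close>. By convexity no predictor beats the posterior
  mixture of \<open>N(0, r)\<close> and \<open>N(t, r)\<close>, and the loss of this mixture at the parameter \<open>t\<close> is the divergence
  \<open>t\<^sup>2 / (2 r)\<close> between the two components minus the mean of \<open>ln (1 + exp E)\<close>, where \<open>E\<close> is the log-odds of \<open>t\<close>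
  after both observations. For this value of \<open>t\<close> the variable \<open>E\<close> is centred under \<open>t\<close> and of order \<open>L\<close>, so
  the correction is \<open>O(L)\<close> and the main term \<open>\<eta> t\<^sup>2 / (2 r)\<close> is the rate.

  Upper bound (\<open>p_TCL_asymp_minimax\<close>). Above the threshold the invariant estimator has bounded risk. Below it the
  marginal density is at most twice its part from the origin (\<open>marg_le\<close>), and the mixture may be compared with any
  one of its components. For \<open>\<bar>\<theta>\<bar> \<le> \<nu>\<close> the component at the origin costs \<open>\<theta>\<^sup>2 / (2 r) + O(1)\<close>. For
  \<open>\<mu>\<^sub>k \<le> \<bar>\<theta>\<bar> \<le> (1 + 2 r) \<mu>\<^sub>k\<close> the component at the cluster point \<open>\<mu>\<^sub>k\<close> of the same sign costs at most
  \<open>(L\<^sup>2 - \<mu>\<^sub>k\<^sup>2) / 2 + O(L)\<close>, which is again bounded by the leading constant because \<open>\<mu>\<^sub>k \<ge> \<nu>\<close> and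
  \<open>\<nu> / L \<rightarrow> sqrt v\<^sub>w\<close>. For \<open>\<bar>\<theta>\<bar>\<close> beyond \<open>L + a\<close> an observation below the threshold is too unlikely to
  matter. At the origin itself the risk is \<open>O(\<eta> L)\<close> (\<open>nn_risk_origin_le\<close>), hence negligible against the rate.
\<close>

section \<open>Gaussian densities\<close>

lemma gauss_eq: "0 < v \<Longrightarrow> gauss \<theta> v y = exp (- (y - \<theta>)\<^sup>2 / (2 * v)) / sqrt (2 * pi * v)"
  by (simp add: gauss_def normal_density_def)

lemma gauss_pos: "0 < v \<Longrightarrow> 0 < gauss \<theta> v y"
  by (simp add: gauss_def normal_density_pos)

lemma gauss_measurable [measurable (raw)]:
  assumes [measurable]: "f \<in> borel_measurable M" "g \<in> borel_measurable M"
  shows "(\<lambda>w. gauss (f w) v (g w)) \<in> borel_measurable M"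
  unfolding gauss_def normal_density_def by measurable

lemma gauss_quadratic:
  assumes "0 < v"
  shows "has_bochner_integral lborel
    (\<lambda>y. gauss \<theta> v y * (A + B * (y - \<theta>) + C * (y - \<theta>)\<^sup>2)) (A + C * v)"
proof -
  have s: "0 < sqrt v" "(sqrt v)\<^sup>2 = v" using assms by auto
  have 0: "has_bochner_integral lborel (\<lambda>y. gauss \<theta> v y * (y - \<theta>) ^ 0) 1"
    using normal_moment_even[OF s(1), of \<theta> 0] by (simp add: gauss_def)
  have 1: "has_bochner_integral lborel (\<lambda>y. gauss \<theta> v y * (y - \<theta>) ^ 1) 0"
    using normal_moment_odd[OF s(1), of \<theta> 0] by (simp add: gauss_def)
  have 2: "has_bochner_integral lborel (\<lambda>y. gauss \<theta> v y * (y - \<theta>) ^ 2) v"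
    using normal_moment_even[OF s(1), of \<theta> 1] s(2) by (simp add: gauss_def fact_numeral)
  have "has_bochner_integral lborel
     (\<lambda>y. A * (gauss \<theta> v y * (y - \<theta>) ^ 0) + B * (gauss \<theta> v y * (y - \<theta>) ^ 1)
        + C * (gauss \<theta> v y * (y - \<theta>) ^ 2)) (A * 1 + B * 0 + C * v)"
    by (intro has_bochner_integral_add has_bochner_integral_mult_right 0 1 2)
  then show ?thesis by (simp add: algebra_simps)
qed

lemma gauss_nn_quadratic:
  assumes "0 < v" "0 \<le> A" "0 \<le> C"
  shows "(\<integral>\<^sup>+ y. ennreal (gauss \<theta> v y * (A + C * (y - \<theta>)\<^sup>2)) \<partial>lborel) = ennreal (A + C * v)"
proof -
  have "has_bochner_integral lborel (\<lambda>y. gauss \<theta> v y * (A + C * (y - \<theta>)\<^sup>2)) (A + C * v)"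
    using gauss_quadratic[OF assms(1), of \<theta> A 0 C] by simp
  then show ?thesis
    using assms less_imp_le[OF gauss_pos[OF assms(1)]]
    by (subst nn_integral_eq_integral)
       (auto simp: has_bochner_integral_iff intro!: AE_I2 mult_nonneg_nonneg)
qed

lemma gauss_nn_integral: "0 < v \<Longrightarrow> (\<integral>\<^sup>+ y. ennreal (gauss \<theta> v y) \<partial>lborel) = 1"
  using gauss_nn_quadratic[of v 1 0 \<theta>] by simp

lemma gauss_has_integral: "0 < v \<Longrightarrow> has_bochner_integral lborel (gauss \<theta> v) 1"
  using gauss_quadratic[of v \<theta> 1 0 0] by simp

lemma ln_gauss_ratio:
  assumes "0 < v"
  shows "ln (gauss \<theta> v y / gauss \<mu> v y) = (\<theta> - \<mu>)\<^sup>2 / (2 * v) + (\<theta> - \<mu>) / v * (y - \<theta>)"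
proof -
  have "gauss \<theta> v y / gauss \<mu> v y = exp ((\<theta> - \<mu>)\<^sup>2 / (2 * v) + (\<theta> - \<mu>) / v * (y - \<theta>))"
    using assms by (simp add: gauss_eq exp_diff[symmetric] field_simps power2_eq_square)
  then show ?thesis by simp
qed

section \<open>Kullback--Leibler loss as the integral of a nonnegative function\<close>

text \<open>
  Adding \<open>b - a\<close> to the integrand does not change its integral when \<open>a\<close> and \<open>b\<close> run through two probability
  densities, but makes it nonnegative. All losses and risks then become Lebesgue integrals of
  \<^typ>\<open>ennreal\<close>-valued functions, where monotonicity and linearity hold without integrability conditions.
\<close>

definition kl_gap :: "real \<Rightarrow> real \<Rightarrow> ennreal" where
  "kl_gap a b = (if b = 0 then \<infinity> else ennreal (a * ln (a / b) - a + b))"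

lemma kl_gap_real_nonneg:
  assumes "0 < a" "0 < b" shows "0 \<le> a * ln (a / b) - a + (b::real)"
proof -
  have "ln (b / a) \<le> b / a - 1" using assms by (intro ln_le_minus_one) auto
  then have "a * ln (b / a) \<le> a * (b / a - 1)" using assms by (intro mult_left_mono) auto
  moreover have "ln (a / b) = - ln (b / a)" using assms by (simp add: ln_div)
  ultimately show ?thesis using assms by (simp add: algebra_simps)
qed

text \<open>
  The positive part of the Kullback--Leibler integrand may have infinite integral, so the comparison with
  \<^const>\<open>kl_gap\<close> is an identity between sums in which nothing is subtracted.
\<close>

lemma kl_gap_split:
  assumes "0 < a" "0 \<le> b"
  shows "e2ennreal (kl_term a b) + ennreal b = kl_gap a b + ennreal a + e2ennreal (- kl_term a b)"
proof (cases "b = 0")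
  case True
  then show ?thesis by (simp add: kl_term_def kl_gap_def)
next
  case False
  then have "0 < b" using assms by simp
  define u where "u = a * ln (a / b)"
  have "0 \<le> u - a + b" using kl_gap_real_nonneg[OF assms(1) \<open>0 < b\<close>] by (simp add: u_def)
  then have "ennreal u + ennreal b = ennreal (u - a + b) + ennreal a + ennreal (- u)"
    using assms by (cases "0 \<le> u") (simp_all add: ennreal_neg flip: ennreal_plus)
  then show ?thesis using False by (simp add: kl_term_def kl_gap_def u_def)
qed

lemma kl_gap_measurable [measurable (raw)]:
  assumes [measurable]: "f \<in> borel_measurable M" "g \<in> borel_measurable M"
  shows "(\<lambda>w. kl_gap (f w) (g w)) \<in> borel_measurable M"
  unfolding kl_gap_def by measurable

definition nn_kl :: "real \<Rightarrow> real \<Rightarrow> (real \<Rightarrow> real) \<Rightarrow> ennreal" where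
  "nn_kl r \<theta> q = (\<integral>\<^sup>+ y. kl_gap (gauss \<theta> r y) (q y) \<partial>lborel)"

definition prob_density :: "(real \<Rightarrow> real) \<Rightarrow> bool" where
  "prob_density q \<longleftrightarrow> q \<in> borel_measurable borel \<and> (\<forall>y. 0 \<le> q y) \<and>
     (\<integral>\<^sup>+ y. ennreal (q y) \<partial>lborel) = 1"

lemma kl_loss_eq_nn_kl:
  assumes r: "0 < r" and "prob_density q"
  shows "kl_loss r \<theta> q = enn2ereal (nn_kl r \<theta> q)"
proof -
  have q [measurable]: "q \<in> borel_measurable borel" and q0: "\<And>y. 0 \<le> q y"
    and q1: "(\<integral>\<^sup>+ y. ennreal (q y) \<partial>lborel) = 1"
    using assms(2) by (auto simp: prob_density_def)
  let ?k = "\<lambda>y. kl_term (gauss \<theta> r y) (q y)"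
  let ?P = "\<integral>\<^sup>+ y. e2ennreal (?k y) \<partial>lborel" and ?N = "\<integral>\<^sup>+ y. e2ennreal (- ?k y) \<partial>lborel"
  have pos: "\<And>y. 0 < gauss \<theta> r y" using gauss_pos[OF r] .
  have pos_eq: "(\<lambda>y. e2ennreal (?k y)) =
      (\<lambda>y. if q y = 0 then \<infinity> else ennreal (gauss \<theta> r y * ln (gauss \<theta> r y / q y)))"
    by (auto simp: kl_term_def)
  have neg_eq: "(\<lambda>y. e2ennreal (- ?k y)) =
      (\<lambda>y. if q y = 0 then 0 else ennreal (- (gauss \<theta> r y * ln (gauss \<theta> r y / q y))))"
    by (auto simp: kl_term_def e2ennreal_neg)
  have [measurable]: "(\<lambda>y. e2ennreal (?k y)) \<in> borel_measurable borel"
    unfolding pos_eq by measurable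
  have [measurable]: "(\<lambda>y. e2ennreal (- ?k y)) \<in> borel_measurable borel"
    unfolding neg_eq by measurable
  have "?P + 1 = (\<integral>\<^sup>+ y. e2ennreal (?k y) + ennreal (q y) \<partial>lborel)"
    by (simp add: nn_integral_add q1)
  also have "\<dots> = (\<integral>\<^sup>+ y. kl_gap (gauss \<theta> r y) (q y) + ennreal (gauss \<theta> r y)
                         + e2ennreal (- ?k y) \<partial>lborel)"
    by (simp add: kl_gap_split pos q0)
  also have "\<dots> = nn_kl r \<theta> q + 1 + ?N"
    by (simp add: nn_integral_add gauss_nn_integral[OF r] nn_kl_def)
  finally have eq: "?P + 1 = nn_kl r \<theta> q + 1 + ?N" .
  \<comment> \<open>The negative part of the integrand is dominated by \<open>q\<close>, so its integral is finite and can be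
    cancelled.\<close>
  have "?N \<le> (\<integral>\<^sup>+ y. ennreal (q y) \<partial>lborel)"
  proof (rule nn_integral_mono)
    fix y
    have "- (gauss \<theta> r y * ln (gauss \<theta> r y / q y)) \<le> q y" if "q y \<noteq> 0"
      using kl_gap_real_nonneg[OF pos[of y], of "q y"] q0[of y] that pos[of y] by auto
    then show "e2ennreal (- ?k y) \<le> ennreal (q y)"
      by (auto simp: kl_term_def e2ennreal_neg intro!: ennreal_leI)
  qed
  then have N: "?N < \<top>" using q1 by (simp add: le_less_trans)
  have "1 + ?P = 1 + (nn_kl r \<theta> q + ?N)" using eq by (simp only: ac_simps)
  then have "?P = nn_kl r \<theta> q + ?N" by (simp add: ennreal_add_left_cancel)
  then have "enn2ereal ?P = enn2ereal (nn_kl r \<theta> q) + enn2ereal ?N"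
    by (simp add: plus_ennreal.rep_eq)
  then show ?thesis using N unfolding kl_loss_def ext_integral_def
    by (cases ?N; cases "nn_kl r \<theta> q") auto
qed

definition nn_risk :: "real \<Rightarrow> real \<Rightarrow> (real \<Rightarrow> real \<Rightarrow> real) \<Rightarrow> ennreal" where
  "nn_risk r \<theta> p = (\<integral>\<^sup>+ x. nn_kl r \<theta> (p x) * ennreal (gauss \<theta> 1 x) \<partial>lborel)"

lemma pred_estimatorsD:
  assumes "p \<in> pred_estimators"
  shows "case_prod p \<in> borel_measurable (borel \<Otimes>\<^sub>M borel)" "prob_density (p x)"
proof -
  show *: "case_prod p \<in> borel_measurable (borel \<Otimes>\<^sub>M borel)"
    using assms by (simp add: pred_estimators_def)
  have "(\<lambda>y. case_prod p (x, y)) \<in> borel_measurable borel"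
    by (rule measurable_compose[OF _ *]) simp
  then show "prob_density (p x)"
    using assms by (auto simp: pred_estimators_def prob_density_def)
qed

lemma risk_eq_nn_risk:
  assumes "0 < r" "\<And>x. prob_density (p x)"
  shows "risk r \<theta> p = enn2ereal (nn_risk r \<theta> p)"
proof -
  have g: "0 \<le> gauss \<theta> 1 x" for x using gauss_pos[of 1 \<theta> x] by simp
  have eq: "kl_loss r \<theta> (p x) * ereal (gauss \<theta> 1 x)
      = enn2ereal (nn_kl r \<theta> (p x) * ennreal (gauss \<theta> 1 x))" for x
    by (simp add: kl_loss_eq_nn_kl[OF assms] times_ennreal.rep_eq g)
  show ?thesis
    unfolding risk_def eq nn_risk_def by (subst ext_integral_nonneg_eq) auto
qed

lemma int_risk_eq_nn_integral:
  assumes "0 < r" "\<And>x. prob_density (p x)"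
  shows "int_risk r \<pi> p = enn2ereal (\<integral>\<^sup>+ \<theta>. nn_risk r \<theta> p \<partial>\<pi>)"
  unfolding int_risk_def risk_eq_nn_risk[OF assms]
  by (subst ext_integral_nonneg_eq) auto

text \<open>
  All predictive densities below are compared with Gaussian ones, whose log-likelihood ratios are quadratic
  in \<open>y\<close>. The linear term drops out because it is centred at the mean of the true density, and the variance
  supplies the factor of \<open>C\<close>.
\<close>

lemma nn_kl_le_quadratic:
  assumes r: "0 < r" and q: "prob_density q" "\<And>y. 0 < q y"
    and le: "\<And>y. ln (gauss \<theta> r y / q y) \<le> A + B * (y - \<theta>) + C * (y - \<theta>)\<^sup>2"
  shows "nn_kl r \<theta> q \<le> ennreal (A + C * r)"
proof -
  let ?g = "gauss \<theta> r"
  let ?h = "\<lambda>y. ?g y * (A + B * (y - \<theta>) + C * (y - \<theta>)\<^sup>2) - ?g y + q y"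
  have pos: "\<And>y. 0 < ?g y" using gauss_pos[OF r] .
  have qm: "q \<in> borel_measurable lborel" "AE y in lborel. 0 \<le> q y"
    "(\<integral>\<^sup>+ y. ennreal (q y) \<partial>lborel) = ennreal 1"
    using q(1) by (simp_all add: prob_density_def)
  have "integrable lborel q" by (rule integrableI_nn_integral_finite[OF qm])
  moreover have "integral\<^sup>L lborel q = 1"
    using integral_eq_nn_integral[OF qm(1,2)] qm(3) by simp
  ultimately have "has_bochner_integral lborel ?h ((A + C * r) - 1 + 1)"
    by (intro has_bochner_integral_add has_bochner_integral_diff gauss_quadratic r
        gauss_has_integral) (simp add: has_bochner_integral_iff)
  then have h: "integrable lborel ?h" "integral\<^sup>L lborel ?h = A + C * r"
    by (auto simp: has_bochner_integral_iff)
  have le_h: "?g y * ln (?g y / q y) - ?g y + q y \<le> ?h y" for y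
    using mult_left_mono[OF le less_imp_le[OF pos]] by simp
  have "0 \<le> ?h y" for y
    using le_h[of y] kl_gap_real_nonneg[OF pos q(2), of y y] by linarith
  then have "(\<integral>\<^sup>+ y. ennreal (?h y) \<partial>lborel) = ennreal (A + C * r)"
    using h by (subst nn_integral_eq_integral) auto
  moreover have "nn_kl r \<theta> q \<le> (\<integral>\<^sup>+ y. ennreal (?h y) \<partial>lborel)"
    unfolding nn_kl_def using le_h less_imp_neq[OF q(2)]
    by (intro nn_integral_mono) (auto simp: kl_gap_def intro!: ennreal_leI)
  ultimately show ?thesis by simp
qed

section \<open>Lower bound: the Bayes risk of the two-point prior\<close>

text \<open>
  The compensation identity: replacing the optimal predictive value \<open>q\<close>, the posterior mixture, by any other
  \<open>p\<close> costs \<open>(W + V)\<close> times the divergence \<open>q ln (q / p) - q + p\<close>, which is nonnegative. The divergence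
  between \<open>a\<close> and \<open>q\<close> is also dropped: in the application it is the loss at the parameter \<open>0\<close>, which is of lower
  order.
\<close>

lemma weighted_kl_gap_mixture:
  fixes a b p W V :: real
  assumes pos: "0 < a" "0 < b" "0 < p" "0 < W" "0 < V"
  defines "q \<equiv> (W * a + V * b) / (W + V)"
  shows "V * (b * ln (b / q) - b + q)
    \<le> W * (a * ln (a / p) - a + p) + V * (b * ln (b / p) - b + p)"
proof -
  have q: "0 < q" "(W + V) * q = W * a + V * b" using pos by (auto simp: q_def add_pos_pos)
  have eq: "W * (a * ln (a / p) - a + p) + V * (b * ln (b / p) - b + p)
      = W * (a * ln (a / q) - a + q) + V * (b * ln (b / q) - b + q)
        + (W + V) * (q * ln (q / p) - q + p)"
  proof -
    have "(W + V) * (q * ln (q / p) - q + p) = ((W + V) * q) * ln (q / p) - (W + V) * q + (W + V) * p"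
      by (simp add: algebra_simps)
    also have "\<dots> = (W * a + V * b) * (ln q - ln p) - (W + V) * q + (W + V) * p"
      using q pos by (simp add: ln_div)
    finally show ?thesis using q(1) pos by (simp add: ln_div algebra_simps)
  qed
  have "0 \<le> W * (a * ln (a / q) - a + q)"
    using kl_gap_real_nonneg[OF pos(1) q(1)] pos by simp
  moreover have "0 \<le> (W + V) * (q * ln (q / p) - q + p)"
    using kl_gap_real_nonneg[OF q(1) pos(3)] pos by simp
  ultimately show ?thesis unfolding eq by linarith
qed

lemma ln_one_plus_exp_le: "ln (1 + exp w) \<le> ln 2 + \<bar>w\<bar>" for w :: real
proof -
  have "1 + exp w \<le> 2 * exp \<bar>w\<bar>"
    using exp_le_cancel_iff[of w "\<bar>w\<bar>"] one_le_exp_iff[of "\<bar>w\<bar>"] by linarith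
  then have "ln (1 + exp w) \<le> ln (2 * exp \<bar>w\<bar>)"
    by (subst ln_le_cancel_iff) (auto intro: add_pos_pos)
  then show ?thesis by (simp add: ln_mult)
qed

lemma abs_le_half_one_plus_square: "\<bar>w\<bar> \<le> (1 + w\<^sup>2) / 2" for w :: real
proof -
  have "0 \<le> (\<bar>w\<bar> - 1)\<^sup>2" by simp
  then show ?thesis by (simp add: power2_diff)
qed

text \<open>
  With \<open>t = \<lambda>\<^sub>f\<close>, the hypothesis on \<open>V / W\<close>, the posterior odds of \<open>t\<close> given \<open>x\<close>, makes the
  log-odds given both \<open>x\<close> and \<open>y\<close> equal to \<open>E = t (x - t) + (t / r) (y - t)\<close>, which has mean zero under
  \<open>t\<close>. This is what singles out \<open>\<lambda>\<^sub>f\<close>: on average the two observations together only just fail to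
  discriminate between \<open>0\<close> and \<open>t\<close>, so the predictor loses almost the full log-likelihood ratio, up to
  \<open>ln (1 + exp E) \<le> ln 2 + \<bar>E\<bar>\<close>, which is of order \<open>t\<close> rather than \<open>t\<^sup>2\<close>. Bounding \<open>\<bar>E\<bar>\<close> by a quadratic avoids
  absolute moments.
\<close>

lemma log_likelihood_mixture_ge:
  fixes r t x y W V :: real
  assumes r: "0 < r" and t: "0 < t" and W: "0 < W" and V: "0 < V"
    and crit: "ln (V / W) = t * (x - t) - (t / r) * t / 2"
  defines "q \<equiv> (W * gauss 0 r y + V * gauss t r y) / (W + V)"
  shows "t\<^sup>2 / (2 * r) - ln 2 - t * (1 + (x - t)\<^sup>2) / 2 - t / (2 * r) + t / r * (y - t)
      - t / (2 * r) * (y - t)\<^sup>2 \<le> ln (gauss t r y / q)"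
proof -
  let ?a = "gauss 0 r y" and ?b = "gauss t r y"
  have pos: "0 < ?a" "0 < ?b" using gauss_pos[OF r] by auto
  define E where "E = t * (x - t) + t / r * (y - t)"
  have lnba: "ln (?b / ?a) = t\<^sup>2 / (2 * r) + t / r * (y - t)"
    using ln_gauss_ratio[OF r, of t y 0] by simp
  have "V * ?b / (W * ?a) = exp E"
  proof -
    have "ln (V * ?b / (W * ?a)) = ln (V / W) + ln (?b / ?a)"
      using pos W V by (simp add: ln_mult ln_div)
    also have "\<dots> = E" unfolding lnba crit E_def by (simp add: field_simps power2_eq_square)
    finally show ?thesis using pos W V by (metis exp_ln divide_pos_pos mult_pos_pos)
  qed
  then have VE: "V * ?b = W * ?a * exp E" using pos W by (simp add: field_simps)
  have q: "0 < q" using pos W V by (auto simp: q_def intro!: divide_pos_pos add_pos_pos)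
  have "q \<le> (W * ?a + V * ?b) / W"
    unfolding q_def using pos W V by (intro divide_left_mono) (auto intro!: add_nonneg_nonneg)
  also have "\<dots> = ?a * (1 + exp E)" using W by (simp add: VE field_simps)
  finally have "ln q \<le> ln (?a * (1 + exp E))"
    using q pos by (subst ln_le_cancel_iff) (auto intro!: mult_pos_pos add_pos_pos)
  also have "\<dots> = ln ?a + ln (1 + exp E)"
    using pos by (subst ln_mult) (auto simp: add_pos_pos less_imp_neq[THEN not_sym])
  finally have "ln (?b / q) \<ge> ln (?b / ?a) - ln (1 + exp E)"
    using pos q by (simp add: ln_div)
  moreover have "\<bar>E\<bar> \<le> t * ((1 + (x - t)\<^sup>2) / 2) + t / r * ((1 + (y - t)\<^sup>2) / 2)"
  proof -
    have "\<bar>E\<bar> \<le> \<bar>t * (x - t)\<bar> + \<bar>t / r * (y - t)\<bar>" unfolding E_def by (rule abs_triangle_ineq)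
    also have "\<dots> = t * \<bar>x - t\<bar> + t / r * \<bar>y - t\<bar>" using t r by (simp add: abs_mult)
    also have "\<dots> \<le> t * ((1 + (x - t)\<^sup>2) / 2) + t / r * ((1 + (y - t)\<^sup>2) / 2)"
      using t r by (intro add_mono mult_left_mono abs_le_half_one_plus_square) auto
    finally show ?thesis .
  qed
  moreover note ln_one_plus_exp_le[of E]
  ultimately have "ln (?b / q) \<ge> t\<^sup>2 / (2 * r) + t / r * (y - t) - ln 2
      - (t * ((1 + (x - t)\<^sup>2) / 2) + t / r * ((1 + (y - t)\<^sup>2) / 2))"
    unfolding lnba by linarith
  moreover have "t / r * ((1 + (y - t)\<^sup>2) / 2) = t / (2 * r) + t / (2 * r) * (y - t)\<^sup>2"
    using r by (simp add: field_simps)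
  ultimately show ?thesis by simp
qed

lemma ennreal_integral_le_nn_integral:
  fixes f :: "'a \<Rightarrow> real"
  assumes "integrable M f"
  shows "ennreal (integral\<^sup>L M f) \<le> (\<integral>\<^sup>+ x. ennreal (f x) \<partial>M)"
proof -
  have "integral\<^sup>L M f \<le> integral\<^sup>L M (\<lambda>x. max 0 (f x))"
    using assms by (intro integral_mono) auto
  then have "ennreal (integral\<^sup>L M f) \<le> ennreal (integral\<^sup>L M (\<lambda>x. max 0 (f x)))"
    by (rule ennreal_leI)
  also have "\<dots> = (\<integral>\<^sup>+ x. ennreal (max 0 (f x)) \<partial>M)"
    using assms by (intro nn_integral_eq_integral[symmetric]) auto
  also have "\<dots> = (\<integral>\<^sup>+ x. ennreal (f x) \<partial>M)"
    by (simp add: ennreal_max_0)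
  finally show ?thesis .
qed

lemma weighted_nn_kl_ge:
  fixes r t x W V :: real
  assumes r: "0 < r" and t: "0 < t" and W: "0 < W" and V: "0 < V"
    and crit: "ln (V / W) = t * (x - t) - (t / r) * t / 2"
    and p: "prob_density p"
  shows "ennreal (V * (t\<^sup>2 / (2 * r) - ln 2 - t * (1 + (x - t)\<^sup>2) / 2 - t / (2 * r) - t / 2))
    \<le> ennreal W * nn_kl r 0 p + ennreal V * nn_kl r t p"
proof -
  let ?a = "gauss 0 r" and ?b = "gauss t r"
  define A where "A = t\<^sup>2 / (2 * r) - ln 2 - t * (1 + (x - t)\<^sup>2) / 2 - t / (2 * r)"
  define q where "q y = (W * ?a y + V * ?b y) / (W + V)" for y
  let ?h = "\<lambda>y. V * (?b y * (A + t / r * (y - t) + - t / (2 * r) * (y - t)\<^sup>2) - ?b y + q y)"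
  have pos: "\<And>y. 0 < ?a y" "\<And>y. 0 < ?b y" using gauss_pos[OF r] by auto
  have [measurable]: "p \<in> borel_measurable borel" and p0: "\<And>y. 0 \<le> p y"
    using p by (auto simp: prob_density_def)
  have "has_bochner_integral lborel q ((W * 1 + V * 1) / (W + V))"
    unfolding q_def
    by (intro has_bochner_integral_divide_zero has_bochner_integral_add
        has_bochner_integral_mult_right gauss_has_integral r)
  then have "has_bochner_integral lborel q 1" using W V by simp
  then have "has_bochner_integral lborel ?h (V * ((A + - t / (2 * r) * r) - 1 + 1))"
    by (intro has_bochner_integral_mult_right has_bochner_integral_add has_bochner_integral_diff
        gauss_quadratic gauss_has_integral r)
  then have h: "integrable lborel ?h" "integral\<^sup>L lborel ?h = V * (A - t / 2)"
    using r by (auto simp: has_bochner_integral_iff)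
  have "ennreal (V * (A - t / 2)) \<le> (\<integral>\<^sup>+ y. ennreal (?h y) \<partial>lborel)"
    using ennreal_integral_le_nn_integral[OF h(1)] unfolding h(2) .
  also have "\<dots> \<le> (\<integral>\<^sup>+ y. ennreal W * kl_gap (?a y) (p y) + ennreal V * kl_gap (?b y) (p y) \<partial>lborel)"
  proof (rule nn_integral_mono)
    fix y
    show "ennreal (?h y) \<le> ennreal W * kl_gap (?a y) (p y) + ennreal V * kl_gap (?b y) (p y)"
    proof (cases "p y = 0")
      case True
      then show ?thesis using W by (simp add: kl_gap_def ennreal_mult_top)
    next
      case False
      then have py: "0 < p y" using p0[of y] by simp
      have ge: "A + t / r * (y - t) + - t / (2 * r) * (y - t)\<^sup>2 \<le> ln (?b y / q y)"
        using log_likelihood_mixture_ge[OF r t W V crit, of y] by (simp add: A_def q_def)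
      have "?h y \<le> V * (?b y * ln (?b y / q y) - ?b y + q y)"
        using mult_left_mono[OF ge less_imp_le[OF pos(2)]] V by (intro mult_left_mono) auto
      also have "\<dots> \<le> W * (?a y * ln (?a y / p y) - ?a y + p y)
          + V * (?b y * ln (?b y / p y) - ?b y + p y)"
        unfolding q_def by (rule weighted_kl_gap_mixture[OF pos(1) pos(2) py W V])
      finally show ?thesis
        using kl_gap_real_nonneg[OF pos(1) py, of y] kl_gap_real_nonneg[OF pos(2) py, of y] W V False
        by (simp add: kl_gap_def flip: ennreal_mult' ennreal_plus)
    qed
  qed
  also have "\<dots> = ennreal W * nn_kl r 0 p + ennreal V * nn_kl r t p"
    unfolding nn_kl_def by (simp add: nn_integral_add nn_integral_cmult)
  finally show ?thesis unfolding A_def .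
qed

lemma nn_kl_measurable:
  assumes [measurable]: "case_prod p \<in> borel_measurable (borel \<Otimes>\<^sub>M borel)"
  shows "(\<lambda>x. nn_kl r \<theta> (p x)) \<in> borel_measurable borel"
  unfolding nn_kl_def by measurable

text \<open>
  The hypothesis on \<open>\<eta> / (1 - \<eta>)\<close> says that \<open>t\<close> is \<open>\<lambda>\<^sub>f\<close>, written without reference to that constant.
\<close>

lemma two_point_nn_risk_ge:
  fixes r t \<eta> :: real
  assumes r: "0 < r" and t: "0 < t" and \<eta>: "0 < \<eta>" "\<eta> < 1"
    and crit: "ln (\<eta> / (1 - \<eta>)) = - (t\<^sup>2 / 2) * (1 + 1 / r)"
    and p: "p \<in> pred_estimators"
  shows "ennreal (\<eta> * (t\<^sup>2 / (2 * r) - ln 2 - 3 / 2 * t - t / (2 * r)))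
    \<le> ennreal (1 - \<eta>) * nn_risk r 0 p + ennreal \<eta> * nn_risk r t p"
proof -
  let ?f = "gauss 0 1" and ?g = "gauss t 1"
  have pos: "\<And>y. 0 < ?f y" "\<And>y. 0 < ?g y" using gauss_pos[of 1] by auto
  note [measurable] = nn_kl_measurable[OF pred_estimatorsD(1)[OF p]]
  define A where "A = t\<^sup>2 / (2 * r) - ln 2 - t / 2 - t / (2 * r) - t / 2"
  let ?h = "\<lambda>x. \<eta> * (?g x * (A + 0 * (x - t) + - t / 2 * (x - t)\<^sup>2))"
  have "has_bochner_integral lborel ?h (\<eta> * (A + - t / 2 * 1))"
    by (intro has_bochner_integral_mult_right gauss_quadratic) simp
  then have h: "integrable lborel ?h" "integral\<^sup>L lborel ?h = \<eta> * (A - t / 2)"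
    by (auto simp: has_bochner_integral_iff)
  have "ennreal (\<eta> * (A - t / 2)) \<le> (\<integral>\<^sup>+ x. ennreal (?h x) \<partial>lborel)"
    using ennreal_integral_le_nn_integral[OF h(1)] unfolding h(2) .
  also have "\<dots> \<le> (\<integral>\<^sup>+ x. ennreal (1 - \<eta>) * (nn_kl r 0 (p x) * ennreal (?f x))
      + ennreal \<eta> * (nn_kl r t (p x) * ennreal (?g x)) \<partial>lborel)"
  proof (rule nn_integral_mono)
    fix x
    let ?W = "(1 - \<eta>) * ?f x" and ?V = "\<eta> * ?g x"
    have WV: "0 < ?W" "0 < ?V" using pos \<eta> by auto
    have "ln (?V / ?W) = ln (\<eta> / (1 - \<eta>)) + ln (?g x / ?f x)"
      using pos[of x] \<eta> by (simp add: ln_mult ln_div)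
    also have "\<dots> = t * (x - t) - (t / r) * t / 2"
      unfolding crit ln_gauss_ratio[of 1, simplified] using r
      by (simp add: field_simps power2_eq_square)
    finally have cr: "ln (?V / ?W) = t * (x - t) - (t / r) * t / 2" .
    have "ennreal (?h x) = ennreal (?V * (t\<^sup>2 / (2 * r) - ln 2 - t * (1 + (x - t)\<^sup>2) / 2 - t / (2 * r) - t / 2))"
      by (simp add: A_def algebra_simps add_divide_distrib diff_divide_distrib)
    also have "\<dots> \<le> ennreal ?W * nn_kl r 0 (p x) + ennreal ?V * nn_kl r t (p x)"
      by (rule weighted_nn_kl_ge[OF r t WV cr pred_estimatorsD(2)[OF p]])
    also have "\<dots> = ennreal (1 - \<eta>) * (nn_kl r 0 (p x) * ennreal (?f x))
      + ennreal \<eta> * (nn_kl r t (p x) * ennreal (?g x))"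
      using \<eta> less_imp_le[OF pos(1)] less_imp_le[OF pos(2)] by (simp add: ennreal_mult mult_ac)
    finally show "ennreal (?h x) \<le> ennreal (1 - \<eta>) * (nn_kl r 0 (p x) * ennreal (?f x))
      + ennreal \<eta> * (nn_kl r t (p x) * ennreal (?g x))" .
  qed
  also have "\<dots> = ennreal (1 - \<eta>) * nn_risk r 0 p + ennreal \<eta> * nn_risk r t p"
    unfolding nn_risk_def by (simp add: nn_integral_add nn_integral_cmult)
  finally show ?thesis by (simp add: A_def algebra_simps)
qed

lemma sets_two_point_prior: "sets (two_point_prior \<eta> t) = sets borel"
  unfolding two_point_prior_def using sets.sigma_sets_eq[of "borel :: real measure"]
  by (subst sets_measure_of) (auto simp: sets.sigma_sets_eq)

lemma space_two_point_prior: "space (two_point_prior \<eta> t) = UNIV"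
  using sets_eq_imp_space_eq[OF sets_two_point_prior] by simp

lemma two_point_prior_sparse:
  assumes "0 \<le> \<eta>" "\<eta> \<le> 1"
  shows "two_point_prior \<eta> t \<in> sparse_priors \<eta>"
proof -
  let ?M = "two_point_prior \<eta> t"
  have "emeasure ?M (space ?M) = 1"
    using assms by (simp add: space_two_point_prior emeasure_two_point_prior flip: ennreal_plus)
  moreover have "emeasure ?M {\<theta>. \<theta> \<noteq> 0} = ennreal \<eta> * indicator {\<theta>. \<theta> \<noteq> 0} t"
    by (subst emeasure_two_point_prior) (auto simp: indicator_def)
  then have "measure ?M {\<theta>. \<theta> \<noteq> 0} \<le> \<eta>"
    using assms by (simp add: measure_def indicator_def)
  ultimately show ?thesis
    using prob_spaceI by (auto simp: sparse_priors_def sets_two_point_prior)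
qed

text \<open>
  The function that agrees with the risk on the two atoms and vanishes elsewhere is simple and lies below the
  risk, so its integral is a lower bound by the definition of the integral.
\<close>

lemma two_point_int_risk_ge:
  assumes "0 < r" "p \<in> pred_estimators" "t \<noteq> 0"
  shows "enn2ereal (ennreal (1 - \<eta>) * nn_risk r 0 p + ennreal \<eta> * nn_risk r t p)
    \<le> int_risk r (two_point_prior \<eta> t) p"
proof -
  let ?M = "two_point_prior \<eta> t" and ?R = "\<lambda>\<theta>. nn_risk r \<theta> p"
  have at: "ennreal (1 - \<eta>) \<le> emeasure ?M {0}" "ennreal \<eta> \<le> emeasure ?M {t}"
    by (simp_all add: emeasure_two_point_prior indicator_def)
  have [measurable]: "{0} \<in> sets ?M" "{t} \<in> sets ?M" by (simp_all add: sets_two_point_prior)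
  have "ennreal (1 - \<eta>) * ?R 0 + ennreal \<eta> * ?R t \<le> ?R 0 * emeasure ?M {0} + ?R t * emeasure ?M {t}"
    using at by (auto simp: mult.commute[of _ "nn_risk r _ p"] intro!: add_mono mult_left_mono)
  also have "\<dots> = (\<integral>\<^sup>+ \<theta>. ?R 0 * indicator {0} \<theta> + ?R t * indicator {t} \<theta> \<partial>?M)"
    by (simp add: nn_integral_add nn_integral_cmult_indicator)
  also have "\<dots> \<le> (\<integral>\<^sup>+ \<theta>. ?R \<theta> \<partial>?M)"
    using assms(3) by (intro nn_integral_mono) (auto simp: indicator_def)
  finally show ?thesis
    using int_risk_eq_nn_integral[OF assms(1) pred_estimatorsD(2)[OF assms(2)], of ?M]
    by (simp add: less_eq_ennreal.rep_eq)
qed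

lemma bayes_risk_two_point_ge:
  fixes r t \<eta> :: real
  assumes r: "0 < r" and t: "0 < t" and \<eta>: "0 < \<eta>" "\<eta> < 1"
    and crit: "ln (\<eta> / (1 - \<eta>)) = - (t\<^sup>2 / 2) * (1 + 1 / r)"
  shows "ereal (\<eta> * (t\<^sup>2 / (2 * r) - ln 2 - 3 / 2 * t - t / (2 * r)))
    \<le> bayes_risk r (two_point_prior \<eta> t)"
  unfolding bayes_risk_def
proof (rule INF_greatest)
  fix p assume p: "p \<in> pred_estimators"
  let ?c = "\<eta> * (t\<^sup>2 / (2 * r) - ln 2 - 3 / 2 * t - t / (2 * r))"
  have "ereal ?c \<le> enn2ereal (ennreal ?c)"
    by (cases "0 \<le> ?c") (auto simp: ennreal_neg zero_ennreal.rep_eq)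
  also have "\<dots> \<le> enn2ereal (ennreal (1 - \<eta>) * nn_risk r 0 p + ennreal \<eta> * nn_risk r t p)"
    using two_point_nn_risk_ge[OF r t \<eta> crit p] by (simp only: less_eq_ennreal.rep_eq)
  also have "\<dots> \<le> int_risk r (two_point_prior \<eta> t) p"
    using two_point_int_risk_ge[OF r p] t by simp
  finally show "ereal ?c \<le> int_risk r (two_point_prior \<eta> t) p" .
qed

section \<open>Predictive densities of finitely supported priors\<close>

definition mix_marginal :: "'i set \<Rightarrow> ('i \<Rightarrow> real) \<Rightarrow> ('i \<Rightarrow> real) \<Rightarrow> real \<Rightarrow> real" where
  "mix_marginal I c z x = (\<Sum>i\<in>I. c i * gauss (z i) 1 x)"

definition mix_pred :: "real \<Rightarrow> 'i set \<Rightarrow> ('i \<Rightarrow> real) \<Rightarrow> ('i \<Rightarrow> real) \<Rightarrow> real \<Rightarrow> real \<Rightarrow> real" where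
  "mix_pred r I c z x y = (\<Sum>i\<in>I. c i * gauss (z i) 1 x / mix_marginal I c z x * gauss (z i) r y)"

text \<open>
  A prior that is known only through its values on Borel sets is identified with the image of a point measure,
  for which integrals are finite sums.
\<close>

lemma integral_finite_prior:
  fixes M :: "real measure" and f :: "real \<Rightarrow> real"
  assumes I: "finite I" and c: "\<And>i. i \<in> I \<Longrightarrow> 0 \<le> c i"
    and M: "sets M = sets borel"
      "\<And>A. A \<in> sets borel \<Longrightarrow> emeasure M A = (\<Sum>i\<in>I. ennreal (c i) * emeasure (return borel (z i)) A)"
    and f: "f \<in> borel_measurable borel"
  shows "integral\<^sup>L M f = (\<Sum>i\<in>I. c i * f (z i))"
proof -
  let ?P = "point_measure I (\<lambda>i. ennreal (c i))"
  have z [measurable]: "z \<in> measurable ?P borel" by simp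
  have "M = distr ?P borel z"
  proof (rule measure_eqI)
    fix A assume "A \<in> sets M"
    then have A: "A \<in> sets borel" by (simp add: M)
    have "emeasure (distr ?P borel z) A = emeasure ?P (z -` A \<inter> I)"
      using A by (subst emeasure_distr) (auto simp: space_point_measure)
    also have "\<dots> = (\<Sum>i\<in>z -` A \<inter> I. ennreal (c i))"
      using I by (intro emeasure_point_measure_finite) auto
    also have "\<dots> = (\<Sum>i\<in>I. ennreal (c i) * indicator A (z i))"
      using I by (intro sum.mono_neutral_cong_left) (auto simp: indicator_def)
    finally show "emeasure M A = emeasure (distr ?P borel z) A"
      using A by (simp add: M)
  qed (simp add: M)
  then have "integral\<^sup>L M f = integral\<^sup>L ?P (\<lambda>i. f (z i))"
    using f by (simp add: integral_distr)
  then show ?thesis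
    using I c by (simp add: lebesgue_integral_point_measure_finite)
qed

lemma bayes_pred_finite_prior:
  fixes M :: "real measure"
  assumes I: "finite I" "I \<noteq> {}" and c: "\<And>i. i \<in> I \<Longrightarrow> 0 < c i"
    and M: "sets M = sets borel"
      "\<And>A. A \<in> sets borel \<Longrightarrow> emeasure M A = (\<Sum>i\<in>I. ennreal (c i) * emeasure (return borel (z i)) A)"
  shows "bayes_pred r M x y = mix_pred r I c z x y"
proof -
  note int = integral_finite_prior[OF I(1) less_imp_le[OF c] M]
  have marg: "(\<integral>\<theta>. gauss \<theta> 1 x \<partial>M) = mix_marginal I c z x"
    unfolding mix_marginal_def by (rule int) auto
  have pos: "0 < mix_marginal I c z x"
    unfolding mix_marginal_def using I c gauss_pos[of 1] by (intro sum_pos) auto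
  have borel: "measurable M = measurable borel" using M(1) by (auto intro: measurable_cong_sets)
  have "bayes_pred r M x y = (\<integral>\<theta>. gauss \<theta> 1 x / mix_marginal I c z x * gauss \<theta> r y \<partial>M)"
    unfolding bayes_pred_def posterior_def marg using pos gauss_pos[of 1]
    by (subst integral_real_density) (auto simp: borel less_imp_le)
  also have "\<dots> = (\<Sum>i\<in>I. c i * (gauss (z i) 1 x / mix_marginal I c z x * gauss (z i) r y))"
    by (rule int) auto
  finally show ?thesis by (simp add: mix_pred_def mult_ac)
qed

lemma mix_marginal_pos:
  assumes "finite I" "I \<noteq> {}" "\<And>i. i \<in> I \<Longrightarrow> 0 < c i"
  shows "0 < mix_marginal I c z x"
  unfolding mix_marginal_def using assms gauss_pos[of 1] by (intro sum_pos) auto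

lemma mix_pred_ge_component:
  assumes "0 < r" "finite I" "\<And>i. i \<in> I \<Longrightarrow> 0 < c i" "i \<in> I"
  shows "c i * gauss (z i) 1 x / mix_marginal I c z x * gauss (z i) r y \<le> mix_pred r I c z x y"
proof -
  have "I \<noteq> {}" using assms by auto
  then have "0 < mix_marginal I c z x" using assms by (intro mix_marginal_pos) auto
  show ?thesis
    unfolding mix_pred_def using assms \<open>0 < mix_marginal I c z x\<close> gauss_pos[of 1] gauss_pos[of r]
    by (intro member_le_sum) (auto intro!: mult_nonneg_nonneg divide_nonneg_nonneg less_imp_le)
qed

lemma mix_pred_estimator:
  assumes r: "0 < r" and I: "finite I" "I \<noteq> {}" and c: "\<And>i. i \<in> I \<Longrightarrow> 0 < c i"
  shows "mix_pred r I c z \<in> pred_estimators"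
  unfolding pred_estimators_def
proof (intro CollectI conjI allI)
  have pos: "0 < mix_marginal I c z x" for x by (rule mix_marginal_pos[OF I c])
  let ?w = "\<lambda>i x. c i * gauss (z i) 1 x / mix_marginal I c z x"
  have w: "0 \<le> ?w i x" if "i \<in> I" for i x
    using c[OF that] pos[of x] gauss_pos[of 1 "z i" x]
    by (intro divide_nonneg_nonneg mult_nonneg_nonneg) auto
  have t: "0 \<le> ?w i x * gauss (z i) r y" if "i \<in> I" for i x y
    using w[OF that] gauss_pos[OF r, of "z i" y] by (intro mult_nonneg_nonneg) auto
  show "case_prod (mix_pred r I c z) \<in> borel_measurable (borel \<Otimes>\<^sub>M borel)"
    unfolding mix_pred_def mix_marginal_def by measurable
  fix x
  show "0 \<le> mix_pred r I c z x y" for y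
    unfolding mix_pred_def by (intro sum_nonneg t)
  have "(\<integral>\<^sup>+ y. ennreal (mix_pred r I c z x y) \<partial>lborel)
      = (\<integral>\<^sup>+ y. (\<Sum>i\<in>I. ennreal (?w i x) * ennreal (gauss (z i) r y)) \<partial>lborel)"
  proof (rule nn_integral_cong)
    fix y
    have "ennreal (mix_pred r I c z x y) = (\<Sum>i\<in>I. ennreal (?w i x * gauss (z i) r y))"
      unfolding mix_pred_def by (rule sum_ennreal[symmetric]) (rule t)
    also have "\<dots> = (\<Sum>i\<in>I. ennreal (?w i x) * ennreal (gauss (z i) r y))"
      by (intro sum.cong refl ennreal_mult' w)
    finally show "ennreal (mix_pred r I c z x y)
      = (\<Sum>i\<in>I. ennreal (?w i x) * ennreal (gauss (z i) r y))" .
  qed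
  also have "\<dots> = (\<Sum>i\<in>I. ennreal (?w i x))"
    using I by (simp add: nn_integral_sum nn_integral_cmult gauss_nn_integral[OF r])
  also have "\<dots> = ennreal (\<Sum>i\<in>I. ?w i x)" by (rule sum_ennreal) (rule w)
  also have "(\<Sum>i\<in>I. ?w i x) = 1"
    using pos[of x] by (simp add: sum_divide_distrib[symmetric] mix_marginal_def)
  finally show "(\<integral>\<^sup>+ y. ennreal (mix_pred r I c z x y) \<partial>lborel) = 1" by simp
qed

text \<open>
  A mixture that contains \<open>N(\<mu>, r)\<close> with weight \<open>w\<close> loses at most \<open>- ln w\<close> more than this component alone.
  For each parameter the upper bounds choose the component that serves it best.
\<close>

lemma nn_kl_le_of_dominated:
  assumes r: "0 < r" and q: "prob_density q" and w: "0 < w" "\<And>y. w * gauss \<mu> r y \<le> q y"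
  shows "nn_kl r \<theta> q \<le> ennreal ((\<theta> - \<mu>)\<^sup>2 / (2 * r) - ln w)"
proof -
  have pos: "\<And>\<theta> y. 0 < gauss \<theta> r y" using gauss_pos[OF r] .
  have q0: "0 < q y" for y using w(2)[of y] mult_pos_pos[OF w(1) pos[of \<mu> y]] by linarith
  have "ln (gauss \<theta> r y / q y)
    \<le> ((\<theta> - \<mu>)\<^sup>2 / (2 * r) - ln w) + (\<theta> - \<mu>) / r * (y - \<theta>) + 0 * (y - \<theta>)\<^sup>2" for y
  proof -
    have "ln (w * gauss \<mu> r y) \<le> ln (q y)"
      using w pos q0 by (subst ln_le_cancel_iff) auto
    then have "ln (gauss \<theta> r y / q y) \<le> ln (gauss \<theta> r y / gauss \<mu> r y) - ln w"
      using w(1) pos[of \<mu> y] pos[of \<theta> y] q0[of y] by (simp add: ln_div ln_mult)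
    then show ?thesis unfolding ln_gauss_ratio[OF r] by simp
  qed
  from nn_kl_le_quadratic[OF r q q0 this] show ?thesis by simp
qed

lemma nn_kl_mix_pred_le:
  assumes r: "0 < r" and I: "finite I" "i \<in> I" and c: "\<And>i. i \<in> I \<Longrightarrow> 0 < c i"
  shows "nn_kl r \<theta> (mix_pred r I c z x)
    \<le> ennreal ((\<theta> - z i)\<^sup>2 / (2 * r) + ln (mix_marginal I c z x / (c i * gauss (z i) 1 x)))"
proof -
  have ne: "I \<noteq> {}" using I by auto
  have pos: "0 < mix_marginal I c z x" by (rule mix_marginal_pos[OF I(1) ne c])
  have ci: "0 < c i * gauss (z i) 1 x" using c[OF I(2)] gauss_pos[of 1] by simp
  have "nn_kl r \<theta> (mix_pred r I c z x)
    \<le> ennreal ((\<theta> - z i)\<^sup>2 / (2 * r) - ln (c i * gauss (z i) 1 x / mix_marginal I c z x))"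
    using pos ci mix_pred_ge_component[OF r I(1) c I(2)]
    by (intro nn_kl_le_of_dominated r pred_estimatorsD(2)[OF mix_pred_estimator[OF r I(1) ne c]]) auto
  also have "(\<theta> - z i)\<^sup>2 / (2 * r) - ln (c i * gauss (z i) 1 x / mix_marginal I c z x)
      = (\<theta> - z i)\<^sup>2 / (2 * r) + ln (mix_marginal I c z x / (c i * gauss (z i) 1 x))"
    using pos ci by (simp add: ln_div)
  finally show ?thesis .
qed

section \<open>The invariant estimator and thresholding\<close>

lemma p_U_estimator: "0 < r \<Longrightarrow> p_U r \<in> pred_estimators"
  unfolding pred_estimators_def p_U_def
  by (auto simp: gauss_nn_integral less_imp_le[OF gauss_pos])

text \<open>
  The bound depends on \<open>x - \<theta>\<close> only, so the invariant estimator costs a bounded amount for every parameter.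
  At the parameter \<open>0\<close>, where only a risk of smaller order than \<open>\<eta> L\<^sup>2\<close> is acceptable, it is in addition used
  with small probability only.
\<close>

lemma nn_kl_p_U_le:
  assumes r: "0 < r"
  shows "nn_kl r \<theta> (p_U r x) \<le> ennreal (ln (1 + 1 / r) / 2 + (x - \<theta>)\<^sup>2 / (2 * (1 + r)))"
proof -
  let ?v = "1 + r"
  have v: "0 < ?v" using r by simp
  have "ln (gauss \<theta> r y / p_U r x y)
    \<le> (ln (1 + 1 / r) / 2 + (x - \<theta>)\<^sup>2 / (2 * ?v)) + (\<theta> - x) / ?v * (y - \<theta>)
      + (1 / (2 * ?v) - 1 / (2 * r)) * (y - \<theta>)\<^sup>2" for y
  proof -
    have e: "exp (a - b) = exp (- b) / exp (- a)" for a b :: real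
      by (simp add: exp_diff exp_minus divide_simps)
    have "gauss \<theta> r y / p_U r x y
      = exp ((y - x)\<^sup>2 / (2 * ?v) - (y - \<theta>)\<^sup>2 / (2 * r)) * (sqrt (2 * pi * ?v) / sqrt (2 * pi * r))"
      using r v by (simp add: gauss_eq p_U_def e)
    moreover have "sqrt (2 * pi * ?v) / sqrt (2 * pi * r) = sqrt (1 + 1 / r)"
      using r by (simp add: real_sqrt_divide[symmetric] field_simps)
    moreover have "0 < 1 + 1 / r" using r by (simp add: add_pos_pos)
    ultimately have ln_eq: "ln (gauss \<theta> r y / p_U r x y)
        = (y - x)\<^sup>2 / (2 * ?v) - (y - \<theta>)\<^sup>2 / (2 * r) + ln (1 + 1 / r) / 2"
      by (simp add: ln_mult ln_sqrt)
    have sq: "(y - x)\<^sup>2 = (x - \<theta>)\<^sup>2 + 2 * (\<theta> - x) * (y - \<theta>) + (y - \<theta>)\<^sup>2"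
      by (simp add: power2_eq_square algebra_simps)
    have cross: "2 * a * b / (2 * w) = a / w * b" for a b w :: real by simp
    show ?thesis unfolding ln_eq sq add_divide_distrib cross left_diff_distrib by simp
  qed
  moreover have "\<And>y. 0 < p_U r x y" using gauss_pos[OF v] by (simp add: p_U_def)
  ultimately have "nn_kl r \<theta> (p_U r x)
    \<le> ennreal (ln (1 + 1 / r) / 2 + (x - \<theta>)\<^sup>2 / (2 * ?v) + (1 / (2 * ?v) - 1 / (2 * r)) * r)"
    by (intro nn_kl_le_quadratic[OF r pred_estimatorsD(2)[OF p_U_estimator[OF r]]])
  also have "\<dots> \<le> ennreal (ln (1 + 1 / r) / 2 + (x - \<theta>)\<^sup>2 / (2 * ?v))"
  proof (rule ennreal_leI)
    have "1 / (2 * ?v) - 1 / (2 * r) \<le> 0" using r by (simp add: frac_le)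
    then have "(1 / (2 * ?v) - 1 / (2 * r)) * r \<le> 0" using r by (simp add: mult_nonpos_nonneg)
    then show "ln (1 + 1 / r) / 2 + (x - \<theta>)\<^sup>2 / (2 * ?v) + (1 / (2 * ?v) - 1 / (2 * r)) * r
      \<le> ln (1 + 1 / r) / 2 + (x - \<theta>)\<^sup>2 / (2 * ?v)" by linarith
  qed
  finally show ?thesis .
qed

definition threshold_pred ::
    "real \<Rightarrow> real \<Rightarrow> (real \<Rightarrow> real \<Rightarrow> real) \<Rightarrow> real \<Rightarrow> real \<Rightarrow> real" where
  "threshold_pred r L q x y = (if \<bar>x\<bar> \<le> L then q x y else p_U r x y)"

lemma threshold_pred_estimator:
  assumes "0 < r" "q \<in> pred_estimators"
  shows "threshold_pred r L q \<in> pred_estimators"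
proof -
  note U = p_U_estimator[OF assms(1)]
  note [measurable] = pred_estimatorsD(1)[OF assms(2)] pred_estimatorsD(1)[OF U]
  have "case_prod (threshold_pred r L q)
      = (\<lambda>w. if \<bar>fst w\<bar> \<le> L then case_prod q w else case_prod (p_U r) w)"
    by (auto simp: threshold_pred_def)
  also have "\<dots> \<in> borel_measurable (borel \<Otimes>\<^sub>M borel)" by measurable
  moreover have "threshold_pred r L q x = (if \<bar>x\<bar> \<le> L then q x else p_U r x)" for x
    by (simp add: threshold_pred_def fun_eq_iff)
  ultimately show ?thesis
    using assms(2) U by (simp add: pred_estimators_def)
qed

lemma nn_kl_threshold_pred:
  "nn_kl r \<theta> (threshold_pred r L q x)
     = (if \<bar>x\<bar> \<le> L then nn_kl r \<theta> (q x) else nn_kl r \<theta> (p_U r x))"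
  by (simp add: threshold_pred_def nn_kl_def)

text \<open>
  The risk of the invariant estimator is the constant \<open>ln (1 + 1 / r) / 2\<close>; the second summand is what the
  cruder bound on its loss costs after integration over \<open>x\<close>.
\<close>

definition p_U_risk_bound :: "real \<Rightarrow> real" where
  "p_U_risk_bound r = ln (1 + 1 / r) / 2 + 1 / (2 * (1 + r))"

lemma p_U_risk_bound_nonneg: "0 < r \<Longrightarrow> 0 \<le> p_U_risk_bound r"
  by (simp add: p_U_risk_bound_def)

lemma nn_risk_threshold_le:
  assumes r: "0 < r" and [measurable]: "G \<in> borel_measurable borel"
    and G: "\<And>x. \<bar>x\<bar> \<le> L \<Longrightarrow> nn_kl r \<theta> (q x) \<le> ennreal (G x)"
  shows "nn_risk r \<theta> (threshold_pred r L q)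
    \<le> (\<integral>\<^sup>+ x. ennreal (G x) * ennreal (gauss \<theta> 1 x) * indicator {-L..L} x \<partial>lborel)
        + ennreal (p_U_risk_bound r)"
proof -
  let ?u = "\<lambda>x. gauss \<theta> 1 x * (ln (1 + 1 / r) / 2 + 1 / (2 * (1 + r)) * (x - \<theta>)\<^sup>2)"
  have g0: "\<And>x. 0 \<le> gauss \<theta> 1 x" using gauss_pos[of 1] by (simp add: less_imp_le)
  have "nn_risk r \<theta> (threshold_pred r L q) \<le> (\<integral>\<^sup>+ x. ennreal (G x) * ennreal (gauss \<theta> 1 x)
      * indicator {-L..L} x + ennreal (?u x) \<partial>lborel)"
    unfolding nn_risk_def nn_kl_threshold_pred
  proof (rule nn_integral_mono)
    fix x
    show "(if \<bar>x\<bar> \<le> L then nn_kl r \<theta> (q x) else nn_kl r \<theta> (p_U r x)) * ennreal (gauss \<theta> 1 x)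
      \<le> ennreal (G x) * ennreal (gauss \<theta> 1 x) * indicator {-L..L} x + ennreal (?u x)"
    proof (cases "\<bar>x\<bar> \<le> L")
      case True
      then have "x \<in> {-L..L}" by auto
      then show ?thesis using mult_right_mono[OF G[OF True]] True by (auto intro!: add_increasing2)
    next
      case False
      have "nn_kl r \<theta> (p_U r x) * ennreal (gauss \<theta> 1 x)
        \<le> ennreal (ln (1 + 1 / r) / 2 + (x - \<theta>)\<^sup>2 / (2 * (1 + r))) * ennreal (gauss \<theta> 1 x)"
        by (intro mult_right_mono nn_kl_p_U_le r) auto
      also have "\<dots> = ennreal (?u x)"
        by (subst mult.commute, subst ennreal_mult'[OF g0, symmetric]) simp
      finally show ?thesis using False by (auto intro: add_increasing)
    qed
  qed
  also have "\<dots> = (\<integral>\<^sup>+ x. ennreal (G x) * ennreal (gauss \<theta> 1 x) * indicator {-L..L} x \<partial>lborel)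
        + ennreal (p_U_risk_bound r)"
    using r gauss_nn_quadratic[of 1 "ln (1 + 1 / r) / 2" "1 / (2 * (1 + r))" \<theta>]
    by (subst nn_integral_add) (auto simp: p_U_risk_bound_def)
  finally show ?thesis .
qed

text \<open>
  For \<open>x\<close> in the interval and \<open>m\<close> the endpoint on the side of \<open>\<theta>\<close>, the distances satisfy
  \<open>(x - \<theta>)\<^sup>2 \<ge> (m - \<theta>)\<^sup>2 + (x - m)\<^sup>2\<close>, so the density is at most the claimed factor times that of \<open>N(m, 1)\<close>.
\<close>

lemma gauss_interval_le:
  assumes "L \<le> \<bar>\<theta>\<bar>" "0 \<le> L"
  shows "(\<integral>\<^sup>+ x. ennreal (gauss \<theta> 1 x) * indicator {-L..L} x \<partial>lborel)
    \<le> ennreal (exp (- (\<bar>\<theta>\<bar> - L)\<^sup>2 / 2))"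
proof -
  define m where "m = sgn \<theta> * L"
  have le: "(\<bar>\<theta>\<bar> - L)\<^sup>2 + (x - m)\<^sup>2 \<le> (x - \<theta>)\<^sup>2" if "-L \<le> x" "x \<le> L" for x
  proof -
    have "0 \<le> (\<bar>\<theta>\<bar> - L) * (L - sgn \<theta> * x)"
      using assms that by (intro mult_nonneg_nonneg) (auto simp: sgn_if)
    then show ?thesis unfolding m_def by (cases "0 \<le> \<theta>")
       (auto simp: sgn_if power2_eq_square algebra_simps split: if_splits)
  qed
  have "(\<integral>\<^sup>+ x. ennreal (gauss \<theta> 1 x) * indicator {-L..L} x \<partial>lborel)
    \<le> (\<integral>\<^sup>+ x. ennreal (exp (- (\<bar>\<theta>\<bar> - L)\<^sup>2 / 2)) * ennreal (gauss m 1 x) \<partial>lborel)"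
  proof (rule nn_integral_mono)
    fix x
    have "gauss \<theta> 1 x \<le> exp (- (\<bar>\<theta>\<bar> - L)\<^sup>2 / 2) * gauss m 1 x" if "x \<in> {-L..L}"
    proof -
      have "exp (- (x - \<theta>)\<^sup>2 / 2) \<le> exp (- (\<bar>\<theta>\<bar> - L)\<^sup>2 / 2) * exp (- (x - m)\<^sup>2 / 2)"
        using le[of x] that by (simp add: mult_exp_exp)
      then show ?thesis by (simp add: gauss_eq divide_right_mono)
    qed
    then show "ennreal (gauss \<theta> 1 x) * indicator {-L..L} x
      \<le> ennreal (exp (- (\<bar>\<theta>\<bar> - L)\<^sup>2 / 2)) * ennreal (gauss m 1 x)"
      by (auto simp: indicator_def ennreal_mult'[symmetric] intro!: ennreal_leI)
  qed
  also have "\<dots> = ennreal (exp (- (\<bar>\<theta>\<bar> - L)\<^sup>2 / 2))"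
    by (simp add: nn_integral_cmult gauss_nn_integral)
  finally show ?thesis .
qed

text \<open>
  The integrand has the explicit antiderivative \<open>- x \<phi>(x)\<close>, and on \<open>x\<^sup>2 \<ge> 2\<close> the function \<open>x\<^sup>2 - 1\<close> dominates
  every quadratic up to a constant.
\<close>

lemma gauss_second_moment_tail:
  assumes "1 \<le> L"
  shows "(\<integral>\<^sup>+ x. ennreal (gauss 0 1 x * (x\<^sup>2 - 1)) * indicator {L..} x \<partial>lborel)
    = ennreal (L * gauss 0 1 L)"
proof -
  let ?F = "\<lambda>x::real. - (x * gauss 0 1 x)"
  define s where "s = 1 / sqrt (2 * pi)"
  have g: "gauss 0 1 x = exp (- x\<^sup>2 / 2) * s" for x by (simp add: gauss_eq s_def)
  have "(\<integral>\<^sup>+ x. ennreal (gauss 0 1 x * (x\<^sup>2 - 1)) * indicator {L..} x \<partial>lborel) = ennreal (0 - ?F L)"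
  proof (rule nn_integral_FTC_atLeast)
    show "(\<lambda>x. gauss 0 1 x * (x\<^sup>2 - 1)) \<in> borel_measurable borel" by measurable
    show "(?F has_real_derivative gauss 0 1 x * (x\<^sup>2 - 1)) (at x)" for x
      unfolding g by (auto intro!: derivative_eq_intros simp: algebra_simps power2_eq_square)
    show "0 \<le> gauss 0 1 x * (x\<^sup>2 - 1)" if "L \<le> x" for x
      using assms that gauss_pos[of 1 0 x] by (intro mult_nonneg_nonneg) auto
    show "(?F \<longlongrightarrow> 0) at_top" unfolding g by real_asymp
  qed
  then show ?thesis by simp
qed

section \<open>Risk of the thresholded cluster predictor\<close>

lemma sum_int_symmetric:
  fixes f :: "int \<Rightarrow> 'a::comm_monoid_add"
  shows "(\<Sum>i\<in>{- int n..int n}. f i) = f 0 + (\<Sum>k = 1..n. f (int k) + f (- int k))"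
proof (induction n)
  case (Suc n)
  have "{- int (Suc n)..int (Suc n)} = insert (int (Suc n)) (insert (- int (Suc n)) {- int n..int n})"
    by auto
  then show ?case using Suc by (simp add: ac_simps)
qed simp

text \<open>
  The loss bound of a cluster point \<open>z\<close> is affine in \<open>x\<close>; the first bracket is its value at \<open>x = \<theta>\<close> and hence
  its mean.
\<close>

lemma cluster_loss_recentred:
  fixes L r \<theta> z x :: real
  shows "(\<theta> - z)\<^sup>2 / (2 * r) + (L\<^sup>2 / 2 - z * x + z\<^sup>2 / 2)
    = ((\<theta> - z)\<^sup>2 / (2 * r) + (\<theta> - z)\<^sup>2 / 2 + (L\<^sup>2 - \<theta>\<^sup>2) / 2) - z * (x - \<theta>)"
  by (simp add: power2_eq_square algebra_simps add_divide_distrib diff_divide_distrib)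

lemma square_times_exp_le_one: "u\<^sup>2 * exp (- u\<^sup>2 / 2) \<le> 1" for u :: real
proof -
  define s where "s = u\<^sup>2 / 2"
  have "0 \<le> (1 - s / 2)\<^sup>2" by simp
  then have "2 * s \<le> (1 + s / 2)\<^sup>2" by (simp add: power2_eq_square algebra_simps)
  also have "\<dots> \<le> (exp (s / 2))\<^sup>2"
    using exp_ge_add_one_self[of "s / 2"] by (intro power_mono) (auto simp: s_def)
  also have "\<dots> = exp s" by (simp add: power2_eq_square mult_exp_exp)
  finally have "2 * s * exp (- s) \<le> exp s * exp (- s)" by (intro mult_right_mono) auto
  then show ?thesis by (simp add: s_def mult_exp_exp)
qed

text \<open>
  The difference of the two sides is \<open>(\<tau> - \<mu>) (\<tau> - (1 + 2 r) \<mu>) / (2 r)\<close>. The upper root explains the ratio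
  \<open>1 + 2 r\<close> between consecutive cluster points: it is the farthest that a point \<open>\<mu>\<close> can serve parameters
  above it no worse than the parameter \<open>\<mu>\<close> itself.
\<close>

lemma quadratic_le_between_roots:
  fixes r \<mu> \<tau> :: real
  assumes "0 < r" "\<mu> \<le> \<tau>" "\<tau> \<le> (1 + 2 * r) * \<mu>"
  shows "(\<tau> - \<mu>)\<^sup>2 / (2 * r) + (\<tau> - \<mu>)\<^sup>2 / 2 - \<tau>\<^sup>2 / 2 \<le> - (\<mu>\<^sup>2 / 2)"
proof -
  have "(\<tau> - \<mu>) * (\<tau> - (1 + 2 * r) * \<mu>) \<le> 0"
    using assms by (intro mult_nonneg_nonpos) auto
  then have "(\<tau> - \<mu>) * (\<tau> - (1 + 2 * r) * \<mu>) / (2 * r) \<le> 0"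
    using assms(1) by (simp add: divide_nonpos_pos)
  also have "(\<tau> - \<mu>) * (\<tau> - (1 + 2 * r) * \<mu>) / (2 * r)
      = (\<tau> - \<mu>)\<^sup>2 / (2 * r) + (\<tau> - \<mu>)\<^sup>2 / 2 - \<tau>\<^sup>2 / 2 + \<mu>\<^sup>2 / 2"
    using assms(1) by (simp add: field_simps power2_eq_square)
  finally show ?thesis by linarith
qed

text \<open>
  The thresholded cluster predictor for arbitrary support points \<open>\<plusminus>\<mu> 1, \<dots>, \<plusminus>\<mu> K\<close>. Only the relation
  between the threshold \<open>L\<close> and the sparsity \<open>\<eta>\<close> is fixed. The atoms are indexed by the integers from \<open>-K\<close>
  to \<open>K\<close>, with the sign of the index as the sign of the atom.
\<close>

locale cluster_threshold =
  fixes r \<eta> L :: real and K :: nat and \<mu> :: "nat \<Rightarrow> real"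
  assumes r: "0 < r" and \<eta>: "0 < \<eta>" "\<eta> < 1" and K: "1 \<le> K" and L: "0 \<le> L"
    and exp_L: "exp (L\<^sup>2 / 2) = (1 - \<eta>) / \<eta>"
begin

definition idx :: "int set" where
  "idx = {- int K..int K}"

definition wt :: "int \<Rightarrow> real" where
  "wt i = (if i = 0 then 1 - \<eta> else \<eta> / (2 * real K))"

definition pt :: "int \<Rightarrow> real" where
  "pt i = of_int (sgn i) * \<mu> (nat \<bar>i\<bar>)"

abbreviation marg :: "real \<Rightarrow> real" where
  "marg \<equiv> mix_marginal idx wt pt"

abbreviation pred :: "real \<Rightarrow> real \<Rightarrow> real" where
  "pred \<equiv> mix_pred r idx wt pt"

abbreviation est :: "real \<Rightarrow> real \<Rightarrow> real" where
  "est \<equiv> threshold_pred r L pred"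

lemma finite_idx [simp]: "finite idx" and zero_in_idx [simp]: "0 \<in> idx"
  by (auto simp: idx_def)

lemma wt_pos: "0 < wt i"
  using \<eta> K by (simp add: wt_def)

lemma pt_0 [simp]: "pt 0 = 0"
  by (simp add: pt_def)

lemma sum_wt: "(\<Sum>i\<in>idx. wt i) = 1"
  using K by (simp add: idx_def sum_int_symmetric wt_def)

lemma est_estimator: "est \<in> pred_estimators"
proof -
  have "idx \<noteq> {}" using zero_in_idx by blast
  then show ?thesis by (intro threshold_pred_estimator mix_pred_estimator r wt_pos) simp_all
qed

lemma marg_ge: "(1 - \<eta>) * gauss 0 1 x \<le> marg x"
proof -
  have "wt 0 * gauss (pt 0) 1 x \<le> (\<Sum>i\<in>idx. wt i * gauss (pt i) 1 x)"
    using gauss_pos[of 1] wt_pos by (intro member_le_sum) (auto intro: less_imp_le)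
  then show ?thesis by (simp add: mix_marginal_def wt_def)
qed

text \<open>
  Below the threshold every likelihood ratio \<open>\<phi>(x - z) / \<phi>(x)\<close> is at most \<open>exp (L\<^sup>2 / 2) = (1 - \<eta>) / \<eta>\<close>, so the
  nonzero atoms together never outweigh the atom at the origin.
\<close>

lemma marg_le:
  assumes "\<bar>x\<bar> \<le> L"
  shows "marg x \<le> 2 * (1 - \<eta>) * gauss 0 1 x"
proof -
  have le: "\<eta> * gauss z 1 x \<le> (1 - \<eta>) * gauss 0 1 x" for z
  proof -
    have "x\<^sup>2 \<le> L\<^sup>2" using assms abs_le_square_iff[of x L] L by simp
    then have "exp (- (x - z)\<^sup>2 / 2) \<le> exp (L\<^sup>2 / 2 + - x\<^sup>2 / 2)"
      using zero_le_power2[of "x - z"] by (subst exp_le_cancel_iff) linarith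
    also have "\<dots> = (1 - \<eta>) / \<eta> * exp (- x\<^sup>2 / 2)" unfolding exp_add exp_L ..
    finally show ?thesis using \<eta> by (simp add: gauss_eq field_simps)
  qed
  have "marg x = (1 - \<eta>) * gauss 0 1 x
      + (\<Sum>k = 1..K. (\<eta> * gauss (\<mu> k) 1 x) / (2 * real K) + (\<eta> * gauss (- \<mu> k) 1 x) / (2 * real K))"
    by (simp add: mix_marginal_def idx_def sum_int_symmetric wt_def pt_def)
  also have "\<dots> \<le> (1 - \<eta>) * gauss 0 1 x
      + (\<Sum>k = 1..K. ((1 - \<eta>) * gauss 0 1 x) / (2 * real K) + ((1 - \<eta>) * gauss 0 1 x) / (2 * real K))"
    by (intro add_left_mono sum_mono add_mono divide_right_mono le) auto
  also have "\<dots> = 2 * (1 - \<eta>) * gauss 0 1 x"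
    using K by simp
  finally show ?thesis .
qed

lemma nn_kl_pred_le_marg:
  "nn_kl r \<theta> (pred x) \<le> ennreal (\<theta>\<^sup>2 / (2 * r) + ln (marg x / ((1 - \<eta>) * gauss 0 1 x)))"
  using nn_kl_mix_pred_le[where c=wt and \<theta>=\<theta> and z=pt and x=x, OF r finite_idx zero_in_idx wt_pos] by (simp add: wt_def)

lemma nn_kl_pred_le_origin:
  assumes "\<bar>x\<bar> \<le> L"
  shows "nn_kl r \<theta> (pred x) \<le> ennreal (\<theta>\<^sup>2 / (2 * r) + ln 2)"
proof -
  have p: "0 < (1 - \<eta>) * gauss 0 1 x" using \<eta> gauss_pos[of 1] by simp
  then have "0 < marg x / ((1 - \<eta>) * gauss 0 1 x)"
    using marg_ge[of x] by (intro divide_pos_pos) auto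
  moreover have "marg x / ((1 - \<eta>) * gauss 0 1 x) \<le> 2"
    using marg_le[OF assms] by (subst pos_divide_le_eq[OF p]) (simp only: mult.assoc)
  ultimately have "ln (marg x / ((1 - \<eta>) * gauss 0 1 x)) \<le> ln 2" by (subst ln_le_cancel_iff) auto
  then show ?thesis by (intro order_trans[OF nn_kl_pred_le_marg] ennreal_leI) simp
qed

lemma nn_kl_pred_le_cluster_point:
  assumes x: "\<bar>x\<bar> \<le> L" and k: "k \<in> {1..K}" and z: "z = \<mu> k \<or> z = - \<mu> k"
  shows "nn_kl r \<theta> (pred x)
    \<le> ennreal (ln (4 * real K) + ((\<theta> - z)\<^sup>2 / (2 * r) + (L\<^sup>2 / 2 - z * x + z\<^sup>2 / 2)))"
proof -
  obtain i where i: "i \<in> idx" "i \<noteq> 0" "pt i = z"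
  proof -
    from z k consider "z = \<mu> k" | "z = - \<mu> k" by auto
    then show ?thesis
    proof cases
      case 1 then show ?thesis using k by (intro that[of "int k"]) (auto simp: idx_def pt_def)
    next
      case 2 then show ?thesis using k by (intro that[of "- int k"]) (auto simp: idx_def pt_def)
    qed
  qed
  have p: "0 < wt i * gauss z 1 x" using wt_pos gauss_pos[of 1] by simp
  have g0: "0 < (1 - \<eta>) * gauss 0 1 x" using \<eta> gauss_pos[of 1] by simp
  have "gauss 0 1 x / gauss z 1 x = exp (- z * x + z\<^sup>2 / 2)"
    by (simp add: gauss_eq exp_diff[symmetric] power2_eq_square field_simps)
  then have "4 * real K * (exp (L\<^sup>2 / 2) * exp (- z * x + z\<^sup>2 / 2))
      = 2 * (1 - \<eta>) * gauss 0 1 x / (wt i * gauss z 1 x)"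
    using i(2) \<eta> K gauss_pos[of 1 z x] by (simp add: exp_L wt_def field_simps)
  then have "marg x / (wt i * gauss z 1 x) \<le> 4 * real K * (exp (L\<^sup>2 / 2) * exp (- z * x + z\<^sup>2 / 2))"
    using marg_le[OF x] p by (simp add: divide_right_mono)
  moreover have "0 < marg x / (wt i * gauss z 1 x)"
    using marg_ge[of x] g0 p by (intro divide_pos_pos) auto
  ultimately have "ln (marg x / (wt i * gauss z 1 x))
      \<le> ln (4 * real K * (exp (L\<^sup>2 / 2) * exp (- z * x + z\<^sup>2 / 2)))"
    using K by (subst ln_le_cancel_iff) auto
  also have "\<dots> = ln (4 * real K) + (L\<^sup>2 / 2 - z * x + z\<^sup>2 / 2)"
    using K by (simp add: ln_mult)
  finally show ?thesis
    using nn_kl_mix_pred_le[where c=wt and \<theta>=\<theta> and z=pt and x=x, OF r finite_idx i(1) wt_pos] i(3)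
    by (elim order_trans) (auto intro!: ennreal_leI)
qed

lemma nn_risk_le_origin_interval:
  "nn_risk r \<theta> est \<le> ennreal (\<theta>\<^sup>2 / (2 * r) + ln 2)
     * (\<integral>\<^sup>+ x. ennreal (gauss \<theta> 1 x) * indicator {-L..L} x \<partial>lborel) + ennreal (p_U_risk_bound r)"
proof -
  have "nn_risk r \<theta> est \<le> (\<integral>\<^sup>+ x. ennreal (\<theta>\<^sup>2 / (2 * r) + ln 2) * ennreal (gauss \<theta> 1 x)
      * indicator {-L..L} x \<partial>lborel) + ennreal (p_U_risk_bound r)"
    by (intro nn_risk_threshold_le r nn_kl_pred_le_origin) simp
  then show ?thesis by (simp add: nn_integral_cmult mult.assoc)
qed

lemma nn_risk_le_near_origin:
  assumes "\<bar>\<theta>\<bar> \<le> \<nu>"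
  shows "nn_risk r \<theta> est \<le> ennreal (\<nu>\<^sup>2 / (2 * r) + ln 2 + p_U_risk_bound r)"
proof -
  have "(\<integral>\<^sup>+ x. ennreal (gauss \<theta> 1 x) * indicator {-L..L} x \<partial>lborel) \<le> 1"
    unfolding gauss_nn_integral[of 1 \<theta>, OF zero_less_one, symmetric]
    by (intro nn_integral_mono) (auto simp: indicator_def)
  then have "nn_risk r \<theta> est \<le> ennreal (\<theta>\<^sup>2 / (2 * r) + ln 2) * 1 + ennreal (p_U_risk_bound r)"
    by (intro order_trans[OF nn_risk_le_origin_interval] add_mono mult_left_mono) auto
  also have "\<dots> = ennreal (\<theta>\<^sup>2 / (2 * r) + ln 2 + p_U_risk_bound r)"
    using r p_U_risk_bound_nonneg[OF r] by simp
  also have "\<dots> \<le> ennreal (\<nu>\<^sup>2 / (2 * r) + ln 2 + p_U_risk_bound r)"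
    using assms r abs_le_square_iff[of \<theta> \<nu>] by (intro ennreal_leI add_mono divide_right_mono) auto
  finally show ?thesis .
qed

text \<open>
  Far parameters rarely produce an observation below the threshold. The probability \<open>exp (- u\<^sup>2 / 2)\<close> with
  \<open>u = \<bar>\<theta>\<bar> - L\<close> beats the quadratic loss of the atom at the origin.
\<close>

lemma nn_risk_le_far:
  assumes a: "0 \<le> a" "L + a \<le> \<bar>\<theta>\<bar>"
  shows "nn_risk r \<theta> est \<le> ennreal (L\<^sup>2 / r * exp (- a\<^sup>2 / 2) + 1 / r + ln 2 + p_U_risk_bound r)"
proof -
  define u where "u = \<bar>\<theta>\<bar> - L"
  let ?e = "exp (- u\<^sup>2 / 2)"
  have u: "a \<le> u" "0 \<le> u" using a by (auto simp: u_def)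
  have e: "?e \<le> exp (- a\<^sup>2 / 2)" "?e \<le> 1" using u a by (auto intro: power_mono)
  have "\<theta>\<^sup>2 = (L + u)\<^sup>2" by (simp add: u_def)
  also have "\<dots> \<le> 2 * L\<^sup>2 + 2 * u\<^sup>2"
    using zero_le_power2[of "L - u"] by (simp add: power2_eq_square algebra_simps)
  finally have "\<theta>\<^sup>2 / (2 * r) \<le> (2 * L\<^sup>2 + 2 * u\<^sup>2) / (2 * r)"
    using r by (intro divide_right_mono) auto
  also have "\<dots> = L\<^sup>2 / r + u\<^sup>2 / r" using r by (simp add: field_simps)
  finally have "(\<theta>\<^sup>2 / (2 * r) + ln 2) * ?e \<le> (L\<^sup>2 / r + u\<^sup>2 / r + ln 2) * ?e"
    by (intro mult_right_mono) auto
  also have "\<dots> = L\<^sup>2 / r * ?e + (u\<^sup>2 * ?e) / r + ln 2 * ?e" by (simp add: algebra_simps)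
  also have "\<dots> \<le> L\<^sup>2 / r * exp (- a\<^sup>2 / 2) + 1 / r + ln 2 * 1"
    using r e square_times_exp_le_one[of u]
    by (intro add_mono mult_left_mono divide_right_mono) auto
  finally have le: "(\<theta>\<^sup>2 / (2 * r) + ln 2) * ?e \<le> L\<^sup>2 / r * exp (- a\<^sup>2 / 2) + 1 / r + ln 2" by simp
  have "nn_risk r \<theta> est \<le> ennreal (\<theta>\<^sup>2 / (2 * r) + ln 2) * ennreal ?e + ennreal (p_U_risk_bound r)"
    using a L unfolding u_def
    by (intro order_trans[OF nn_risk_le_origin_interval] add_mono mult_left_mono gauss_interval_le) auto
  also have "\<dots> = ennreal ((\<theta>\<^sup>2 / (2 * r) + ln 2) * ?e + p_U_risk_bound r)"
    using r p_U_risk_bound_nonneg[OF r]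
    by (subst ennreal_plus) (auto simp: ennreal_mult'' intro!: mult_nonneg_nonneg add_nonneg_nonneg)
  also have "\<dots> \<le> ennreal (L\<^sup>2 / r * exp (- a\<^sup>2 / 2) + 1 / r + ln 2 + p_U_risk_bound r)"
    using le by (intro ennreal_leI) simp
  finally show ?thesis .
qed

text \<open>
  The mean loss is at most \<open>(L\<^sup>2 - (\<mu> k)\<^sup>2) / 2\<close> up to the cost \<open>ln (4 K)\<close> of sharing the mass among the atoms:
  as \<open>\<bar>\<theta>\<bar>\<close> moves up from \<open>\<mu> k\<close>, the decrease of \<open>(L\<^sup>2 - \<theta>\<^sup>2) / 2\<close> pays for the terms quadratic in the distance.
  The fluctuation \<open>- z (x - \<theta>)\<close> adds a term of order \<open>\<mu> k\<close> only. Since \<open>\<mu> k\<close> may exceed \<open>L\<close>, the bound is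
  stated with \<open>\<nu> \<le> L\<close> in its place, which keeps it nonnegative.
\<close>

lemma nn_risk_le_cluster_point:
  assumes k: "k \<in> {1..K}" and \<mu>: "0 \<le> \<nu>" "\<nu> \<le> \<mu> k" "\<nu> \<le> L"
    and \<theta>: "\<mu> k \<le> \<bar>\<theta>\<bar>" "\<bar>\<theta>\<bar> \<le> (1 + 2 * r) * \<mu> k"
  shows "nn_risk r \<theta> est \<le> ennreal ((L\<^sup>2 - \<nu>\<^sup>2) / 2 + ln (4 * real K) + \<mu> k + p_U_risk_bound r)"
proof -
  define z where "z = (if 0 \<le> \<theta> then \<mu> k else - \<mu> k)"
  have z: "z = \<mu> k \<or> z = - \<mu> k" "\<bar>z\<bar> = \<mu> k" using \<mu> by (auto simp: z_def)
  have sq: "(\<theta> - z)\<^sup>2 = (\<bar>\<theta>\<bar> - \<mu> k)\<^sup>2" by (auto simp: z_def power2_eq_square algebra_simps)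
  define Q where "Q = (L\<^sup>2 - \<nu>\<^sup>2) / 2 + ln (4 * real K)"
  have lnK: "0 \<le> ln (4 * real K)" using K by simp
  have "\<nu>\<^sup>2 \<le> L\<^sup>2" "\<nu>\<^sup>2 \<le> (\<mu> k)\<^sup>2" using \<mu> by (auto intro: power_mono)
  then have Q: "0 \<le> Q" using lnK by (simp add: Q_def)
  let ?G = "\<lambda>x. (Q + \<mu> k / 2) + \<mu> k / 2 * (x - \<theta>)\<^sup>2"
  have G: "nn_kl r \<theta> (pred x) \<le> ennreal (?G x)" if "\<bar>x\<bar> \<le> L" for x
  proof (rule order_trans[OF nn_kl_pred_le_cluster_point[OF that k z(1)] ennreal_leI])
    have "(\<theta> - z)\<^sup>2 / (2 * r) + (\<theta> - z)\<^sup>2 / 2 + (L\<^sup>2 - \<theta>\<^sup>2) / 2 \<le> (L\<^sup>2 - (\<mu> k)\<^sup>2) / 2"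
      using quadratic_le_between_roots[OF r \<theta>] unfolding sq by (simp add: diff_divide_distrib)
    also have "\<dots> \<le> (L\<^sup>2 - \<nu>\<^sup>2) / 2" using \<open>\<nu>\<^sup>2 \<le> (\<mu> k)\<^sup>2\<close> by simp
    finally have "(\<theta> - z)\<^sup>2 / (2 * r) + (\<theta> - z)\<^sup>2 / 2 + (L\<^sup>2 - \<theta>\<^sup>2) / 2 \<le> (L\<^sup>2 - \<nu>\<^sup>2) / 2" .
    moreover have "- (z * (x - \<theta>)) \<le> \<mu> k / 2 + \<mu> k / 2 * (x - \<theta>)\<^sup>2"
    proof -
      have "- (z * (x - \<theta>)) \<le> \<mu> k * \<bar>x - \<theta>\<bar>" using abs_ge_minus_self[of "z * (x - \<theta>)"] z(2)
        by (simp add: abs_mult)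
      also have "\<dots> \<le> \<mu> k * ((1 + (x - \<theta>)\<^sup>2) / 2)"
        using \<mu> by (intro mult_left_mono abs_le_half_one_plus_square) auto
      finally show ?thesis by (simp add: algebra_simps add_divide_distrib)
    qed
    ultimately show "ln (4 * real K) + ((\<theta> - z)\<^sup>2 / (2 * r) + (L\<^sup>2 / 2 - z * x + z\<^sup>2 / 2)) \<le> ?G x"
      unfolding cluster_loss_recentred Q_def by linarith
  qed
  have "nn_risk r \<theta> est \<le> (\<integral>\<^sup>+ x. ennreal (?G x) * ennreal (gauss \<theta> 1 x) * indicator {-L..L} x \<partial>lborel)
      + ennreal (p_U_risk_bound r)"
    by (rule nn_risk_threshold_le[OF r _ G]) auto
  also have "(\<integral>\<^sup>+ x. ennreal (?G x) * ennreal (gauss \<theta> 1 x) * indicator {-L..L} x \<partial>lborel)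
      \<le> (\<integral>\<^sup>+ x. ennreal (gauss \<theta> 1 x * ?G x) \<partial>lborel)"
    using gauss_pos[of 1 \<theta>]
    by (intro nn_integral_mono)
       (auto simp: indicator_def ennreal_mult' less_imp_le mult.commute)
  also have "\<dots> = ennreal ((Q + \<mu> k / 2) + \<mu> k / 2 * 1)"
    using Q \<mu> by (intro gauss_nn_quadratic) auto
  finally show ?thesis
    using Q \<mu> p_U_risk_bound_nonneg[OF r] by (simp add: Q_def flip: ennreal_plus) (simp add: add_ac)
qed

text \<open>
  Below the threshold the loss is at most \<open>ln (m / w) \<le> m / w - 1\<close>, where \<open>m\<close> is the marginal density and \<open>w\<close> its
  part from the origin; integrated, this is the prior odds of the nonzero atoms. Above it the loss is quadratic
  in \<open>x\<close>, and the Gaussian tail at \<open>L\<close> contributes a factor \<open>exp (- L\<^sup>2 / 2) = \<eta> / (1 - \<eta>)\<close> as well.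
\<close>

lemma nn_risk_origin_le:
  assumes L2: "2 \<le> L\<^sup>2"
  shows "nn_risk r 0 est \<le> ennreal (\<eta> / (1 - \<eta>) * (1 + 2 * (ln (1 + 1 / r) / 2 + 1 / (1 + r)) * L))"
proof -
  define E where "E = ln (1 + 1 / r) / 2 + 1 / (1 + r)"
  have E: "0 \<le> E" using r by (simp add: E_def)
  have L1: "1 \<le> L"
  proof (rule ccontr)
    assume "\<not> 1 \<le> L"
    then have "L\<^sup>2 < 1" using L by (simp add: power_less_one_iff)
    then show False using L2 by simp
  qed
  let ?g = "gauss 0 1"
  let ?m = "\<lambda>x. marg x / (1 - \<eta>) - ?g x"
  let ?h = "\<lambda>x. ennreal (?g x * (x\<^sup>2 - 1)) * indicator {L..} x"
  have g: "\<And>x. 0 < ?g x" using gauss_pos[of 1] by simp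
  have m0: "0 \<le> ?m x" for x using marg_ge[of x] \<eta> by (simp add: field_simps)
  have even: "?g (- x) = ?g x" for x by (simp add: gauss_eq)
  have "nn_risk r 0 est \<le> (\<integral>\<^sup>+ x. ennreal (?m x) + ennreal E * (?h x + ?h (- x)) \<partial>lborel)"
    unfolding nn_risk_def nn_kl_threshold_pred
  proof (rule nn_integral_mono)
    fix x
    show "(if \<bar>x\<bar> \<le> L then nn_kl r 0 (pred x) else nn_kl r 0 (p_U r x)) * ennreal (?g x)
      \<le> ennreal (?m x) + ennreal E * (?h x + ?h (- x))"
    proof (cases "\<bar>x\<bar> \<le> L")
      case True
      have p: "0 < (1 - \<eta>) * ?g x" using \<eta> g by simp
      have "ln (marg x / ((1 - \<eta>) * ?g x)) \<le> marg x / ((1 - \<eta>) * ?g x) - 1"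
        using marg_ge[of x] p by (intro ln_le_minus_one divide_pos_pos) auto
      then have "nn_kl r 0 (pred x) \<le> ennreal (marg x / ((1 - \<eta>) * ?g x) - 1)"
        by (intro order_trans[OF nn_kl_pred_le_marg] ennreal_leI) simp
      then have "nn_kl r 0 (pred x) * ennreal (?g x)
          \<le> ennreal (marg x / ((1 - \<eta>) * ?g x) - 1) * ennreal (?g x)"
        by (rule mult_right_mono) simp
      also have "\<dots> = ennreal ((marg x / ((1 - \<eta>) * ?g x) - 1) * ?g x)"
        using g[of x] by (simp add: ennreal_mult'')
      also have "(marg x / ((1 - \<eta>) * ?g x) - 1) * ?g x = ?m x"
        using g[of x] \<eta> by (simp add: field_simps)
      finally show ?thesis using True by (auto intro: add_increasing2)
    next
      case False
      have "L\<^sup>2 \<le> x\<^sup>2" using False L by (intro abs_le_square_iff[THEN iffD1]) auto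
      then have x2: "2 \<le> x\<^sup>2" using L2 by simp
      have "nn_kl r 0 (p_U r x) \<le> ennreal (ln (1 + 1 / r) / 2 + 1 / (1 + r) * (x\<^sup>2 / 2))"
        using nn_kl_p_U_le[OF r, of 0 x] by (simp add: field_simps)
      also have "\<dots> \<le> ennreal (E * (x\<^sup>2 - 1))"
      proof (rule ennreal_leI)
        have "ln (1 + 1 / r) / 2 * 1 + 1 / (1 + r) * (x\<^sup>2 / 2)
          \<le> ln (1 + 1 / r) / 2 * (x\<^sup>2 - 1) + 1 / (1 + r) * (x\<^sup>2 - 1)"
          using r x2 by (intro add_mono mult_left_mono) auto
        then show "ln (1 + 1 / r) / 2 + 1 / (1 + r) * (x\<^sup>2 / 2) \<le> E * (x\<^sup>2 - 1)"
          by (simp add: E_def distrib_right)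
      qed
      finally have "nn_kl r 0 (p_U r x) * ennreal (?g x) \<le> ennreal (E * (x\<^sup>2 - 1)) * ennreal (?g x)"
        by (rule mult_right_mono) simp
      also have "\<dots> = ennreal E * ennreal (?g x * (x\<^sup>2 - 1))"
        using E x2 g[of x] by (simp add: ennreal_mult mult_ac)
      also have "\<dots> \<le> ennreal E * (?h x + ?h (- x))"
        using False even[of x] by (intro mult_left_mono) (auto simp: indicator_def)
      finally show ?thesis using False by (auto intro: add_increasing)
    qed
  qed
  also have "\<dots> = (\<integral>\<^sup>+ x. ennreal (?m x) \<partial>lborel)
      + ennreal E * ((\<integral>\<^sup>+ x. ?h x \<partial>lborel) + (\<integral>\<^sup>+ x. ?h (- x) \<partial>lborel))"
    unfolding mix_marginal_def by (simp add: nn_integral_add nn_integral_cmult)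
  also have "(\<integral>\<^sup>+ x. ?h (- x) \<partial>lborel) = (\<integral>\<^sup>+ x. ?h x \<partial>lborel)"
    using nn_integral_real_affine[of ?h "-1" 0] by simp
  also have "(\<integral>\<^sup>+ x. ?h x \<partial>lborel) = ennreal (L * ?g L)"
    by (rule gauss_second_moment_tail[OF L1])
  also have "(\<integral>\<^sup>+ x. ennreal (?m x) \<partial>lborel) = ennreal (\<eta> / (1 - \<eta>))"
  proof -
    have "has_bochner_integral lborel ?m ((\<Sum>i\<in>idx. wt i * 1) / (1 - \<eta>) - 1)"
      unfolding mix_marginal_def
      by (intro has_bochner_integral_diff has_bochner_integral_divide_zero has_bochner_integral_sum
          has_bochner_integral_mult_right gauss_has_integral) simp_all
    moreover have "(\<Sum>i\<in>idx. wt i * 1) / (1 - \<eta>) - 1 = \<eta> / (1 - \<eta>)"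
      using \<eta> by (simp add: sum_wt field_simps)
    ultimately show ?thesis using m0
      by (subst nn_integral_eq_integral) (auto simp: has_bochner_integral_iff)
  qed
  also have "ennreal (\<eta> / (1 - \<eta>)) + ennreal E * (ennreal (L * ?g L) + ennreal (L * ?g L))
      = ennreal (\<eta> / (1 - \<eta>) + E * (2 * (L * ?g L)))"
    using \<eta> E L g[of L] by (simp add: less_imp_le flip: ennreal_plus ennreal_mult)
  also have "\<dots> \<le> ennreal (\<eta> / (1 - \<eta>) + E * (2 * (L * (\<eta> / (1 - \<eta>)))))"
  proof (intro ennreal_leI add_left_mono mult_left_mono)
    \<comment> \<open>This is where the threshold is calibrated against the sparsity.\<close>
    have "exp (- L\<^sup>2 / 2) = \<eta> / (1 - \<eta>)" using exp_L by (simp add: exp_minus)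
    moreover have "1 \<le> sqrt (2 * pi)" using pi_gt3 by simp
    ultimately show "?g L \<le> \<eta> / (1 - \<eta>)"
      using \<eta> by (simp add: gauss_eq divide_le_eq mult_le_cancel_left1)
  qed (use E L in auto)
  also have "\<eta> / (1 - \<eta>) + E * (2 * (L * (\<eta> / (1 - \<eta>)))) = \<eta> / (1 - \<eta>) * (1 + 2 * E * L)"
    by (simp add: algebra_simps)
  finally show ?thesis unfolding E_def .
qed

end

section \<open>The cluster prior and its parameters\<close>

text \<open>
  The grid with ratio \<open>q\<close> that starts at \<open>\<nu>\<close> and stops before \<open>T\<close>. By Bernoulli's inequality its size is bounded
  in terms of \<open>T / \<nu>\<close>; for the cluster prior this ratio stays bounded as \<open>\<eta> \<rightarrow> 0\<close>, so the number of
  clusters does not affect the leading order of the risk.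
\<close>

lemma geometric_grid:
  fixes q \<nu> T :: real
  assumes q: "1 < q" and \<nu>: "0 < \<nu>" "\<nu> \<le> T"
  defines "S \<equiv> {k::nat. 1 \<le> k \<and> q ^ (k - 1) * \<nu> \<le> T}"
  shows "1 \<le> Max S" "real (Max S) \<le> 1 + (T / \<nu> - 1) / (q - 1)"
    "\<And>k. k \<in> {1..Max S} \<Longrightarrow> q ^ (k - 1) * \<nu> \<le> T"
    "\<And>\<tau>. \<nu> \<le> \<tau> \<Longrightarrow> \<tau> \<le> T \<Longrightarrow> \<exists>k\<in>{1..Max S}. q ^ (k - 1) * \<nu> \<le> \<tau> \<and> \<tau> \<le> q * (q ^ (k - 1) * \<nu>)"
proof -
  have bnd: "real k \<le> 1 + (T / \<nu> - 1) / (q - 1)" if "k \<in> S" for k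
  proof -
    have "1 + real (k - 1) * (q - 1) \<le> (1 + (q - 1)) ^ (k - 1)"
      using q by (intro Bernoulli_inequality) auto
    also have "\<dots> \<le> T / \<nu>" using that \<nu> by (simp add: S_def pos_le_divide_eq)
    finally have "real (k - 1) * (q - 1) \<le> T / \<nu> - 1" by simp
    then have "real (k - 1) \<le> (T / \<nu> - 1) / (q - 1)" using q by (simp add: pos_le_divide_eq)
    moreover have "real (k - 1) = real k - 1" using that by (simp add: S_def of_nat_diff)
    ultimately show ?thesis by simp
  qed
  define C where "C = 1 + (T / \<nu> - 1) / (q - 1)"
  have "S \<subseteq> {..nat \<lfloor>C\<rfloor>}"
    using bnd unfolding C_def[symmetric] by (auto intro: le_nat_floor)
  then have fin: "finite S" by (rule finite_subset) simp
  have 1: "1 \<in> S" using \<nu> by (simp add: S_def)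
  have MaxS: "Max S \<in> S" using fin 1 by (intro Max_in) auto
  show "1 \<le> Max S" using Max_ge[OF fin 1] .
  show "real (Max S) \<le> 1 + (T / \<nu> - 1) / (q - 1)" by (rule bnd[OF MaxS])
  show "q ^ (k - 1) * \<nu> \<le> T" if k: "k \<in> {1..Max S}" for k
  proof -
    have "q ^ (k - 1) * \<nu> \<le> q ^ (Max S - 1) * \<nu>"
      using k q \<nu> by (intro mult_right_mono power_increasing) auto
    then show ?thesis using MaxS by (simp add: S_def)
  qed
  show "\<exists>k\<in>{1..Max S}. q ^ (k - 1) * \<nu> \<le> \<tau> \<and> \<tau> \<le> q * (q ^ (k - 1) * \<nu>)"
    if \<tau>: "\<nu> \<le> \<tau>" "\<tau> \<le> T" for \<tau>
  proof -
    let ?A = "{k\<in>S. q ^ (k - 1) * \<nu> \<le> \<tau>}"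
    have finA: "finite ?A" using fin by simp
    have "1 \<in> ?A" using 1 \<tau> by simp
    then have "Max ?A \<in> ?A" using finA by (intro Max_in) auto
    then obtain m where m: "m \<in> ?A" "\<And>k. k \<in> ?A \<Longrightarrow> k \<le> m" using Max_ge[OF finA] by blast
    have "\<tau> \<le> q * (q ^ (m - 1) * \<nu>)"
    proof (rule ccontr)
      assume "\<not> \<tau> \<le> q * (q ^ (m - 1) * \<nu>)"
      moreover have "q * (q ^ (m - 1) * \<nu>) = q ^ (Suc m - 1) * \<nu>"
        using m(1) by (cases m) (auto simp: S_def)
      ultimately have "q ^ (Suc m - 1) * \<nu> \<le> \<tau>" by (metis linear)
      then have "Suc m \<in> ?A" using \<tau> by (simp add: S_def)
      then show False using m(2)[of "Suc m"] by simp
    qed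
    moreover have "m \<in> {1..Max S}" using m(1) Max_ge[OF fin] by (auto simp: S_def)
    ultimately show ?thesis using m(1) by blast
  qed
qed

lemma cl_mu_eq:
  assumes "0 < lambda_e \<eta>"
  shows "cl_mu r \<eta> = sqrt ((cl_a r \<eta>)\<^sup>2 + (lambda_e \<eta>)\<^sup>2) - cl_a r \<eta>"
proof -
  let ?a = "cl_a r \<eta>" and ?L = "lambda_e \<eta>"
  let ?s = "sqrt (?a\<^sup>2 + ?L\<^sup>2)"
  have s: "\<bar>?a\<bar> < ?s" "?s\<^sup>2 = ?a\<^sup>2 + ?L\<^sup>2"
    using assms by (auto intro: real_less_rsqrt)
  show ?thesis unfolding cl_mu_def
  proof (rule the_equality)
    show "0 < ?s - ?a \<and> (?s - ?a)\<^sup>2 + 2 * ?a * (?s - ?a) = ?L\<^sup>2"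
      using s by (auto simp: power2_diff power2_eq_square algebra_simps)
    fix \<mu> assume \<mu>: "0 < \<mu> \<and> \<mu>\<^sup>2 + 2 * ?a * \<mu> = ?L\<^sup>2"
    then have "(\<mu> + ?a)\<^sup>2 = ?s\<^sup>2" using s(2) by (simp add: power2_sum algebra_simps)
    then have "\<mu> + ?a = ?s \<or> \<mu> + ?a = - ?s" by (simp only: power2_eq_iff)
    then show "\<mu> = ?s - ?a" using \<mu> s(1) by auto
  qed
qed

lemma sets_cluster_prior: "sets (cluster_prior r \<eta>) = sets borel"
  unfolding cluster_prior_def using sets.sigma_sets_eq[of "borel :: real measure"]
  by (subst sets_measure_of) auto

lemma (in cluster_threshold) p_TCL_eq_est:
  assumes "L = lambda_e \<eta>" "K = cl_K r \<eta>" "\<mu> = cl_point r \<eta>"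
  shows "p_TCL r \<eta> = est"
proof -
  have "emeasure (cluster_prior r \<eta>) A = (\<Sum>i\<in>idx. ennreal (wt i) * emeasure (return borel (pt i)) A)"
    if "A \<in> sets borel" for A
    using that
    by (simp add: emeasure_cluster_prior idx_def sum_int_symmetric wt_def pt_def assms(2,3)[symmetric]
        sum_distrib_left distrib_left)
  moreover have "idx \<noteq> {}" using zero_in_idx by blast
  ultimately have "bayes_pred r (cluster_prior r \<eta>) x y = pred x y" for x y
    using sets_cluster_prior by (intro bayes_pred_finite_prior finite_idx wt_pos)
  then show ?thesis by (simp add: p_TCL_def threshold_pred_def fun_eq_iff assms(1))
qed

text \<open>
  A sparse prior puts mass at most \<open>\<eta>\<close> on nonzero parameters, so a risk of order \<open>L\<^sup>2\<close> is tolerable there, while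
  at the origin it must be of smaller order than \<open>\<eta> L\<^sup>2\<close>.
\<close>

lemma int_risk_sparse_le:
  assumes r: "0 < r" and p: "p \<in> pred_estimators" and \<pi>: "\<pi> \<in> sparse_priors \<eta>"
    and R: "0 \<le> R" "\<And>\<theta>. nn_risk r \<theta> p \<le> ennreal R"
    and R0: "0 \<le> R0" "nn_risk r 0 p \<le> ennreal R0" and \<eta>: "0 \<le> \<eta>"
  shows "int_risk r \<pi> p \<le> ereal (\<eta> * R + R0)"
proof -
  interpret prob_space \<pi> using \<pi> by (simp add: sparse_priors_def)
  have sets: "{\<theta>. \<theta> \<noteq> 0} \<in> sets \<pi>" using \<pi> by (auto simp: sparse_priors_def)
  have "(\<integral>\<^sup>+ \<theta>. nn_risk r \<theta> p \<partial>\<pi>)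
      \<le> (\<integral>\<^sup>+ \<theta>. ennreal R * indicator {\<theta>. \<theta> \<noteq> 0} \<theta> + ennreal R0 \<partial>\<pi>)"
    using R R0 by (intro nn_integral_mono) (auto simp: indicator_def intro: add_increasing2)
  also have "\<dots> = ennreal R * emeasure \<pi> {\<theta>. \<theta> \<noteq> 0} + ennreal R0"
    using sets by (simp add: nn_integral_add nn_integral_cmult_indicator emeasure_space_1)
  also have "\<dots> \<le> ennreal R * ennreal \<eta> + ennreal R0"
    using \<pi> by (intro add_right_mono mult_left_mono)
      (auto simp: emeasure_eq_measure sparse_priors_def intro: ennreal_leI)
  also have "\<dots> = ennreal (\<eta> * R + R0)"
    using R R0 \<eta> by (simp add: ennreal_mult' mult.commute)
  finally have "(\<integral>\<^sup>+ \<theta>. nn_risk r \<theta> p \<partial>\<pi>) \<le> ennreal (\<eta> * R + R0)" .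
  then have "enn2ereal (\<integral>\<^sup>+ \<theta>. nn_risk r \<theta> p \<partial>\<pi>) \<le> enn2ereal (ennreal (\<eta> * R + R0))"
    by (simp only: less_eq_ennreal.rep_eq)
  also have "\<dots> = ereal (\<eta> * R + R0)"
    using R R0 \<eta> by (intro enn2ereal_ennreal) simp
  finally show ?thesis
    unfolding int_risk_eq_nn_integral[OF r pred_estimatorsD(2)[OF p]] .
qed

section \<open>Asymptotics\<close>

text \<open>
  The cluster parameters \<open>a\<close> and \<open>\<nu>\<close> as functions of \<open>L = \<lambda>\<^sub>e\<close>, with \<open>s\<close> for \<open>sqrt v\<^sub>w\<close>. All limits
  \<open>\<eta> \<rightarrow> 0\<close> are taken as \<open>L \<rightarrow> \<infinity>\<close>.
\<close>

definition grid_a :: "real \<Rightarrow> real \<Rightarrow> real" where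
  "grid_a s L = sqrt (2 * ln (s * L))"

definition grid_nu :: "real \<Rightarrow> real \<Rightarrow> real" where
  "grid_nu s L = s * (sqrt ((grid_a s L)\<^sup>2 + L\<^sup>2) - grid_a s L)"

lemma grid_a_limit:
  assumes "0 < s"
  shows "((\<lambda>L. grid_a s L / L) \<longlongrightarrow> 0) at_top"
  unfolding grid_a_def using assms by real_asymp

lemma grid_nu_limit:
  assumes "0 < s"
  shows "((\<lambda>L. grid_nu s L / L) \<longlongrightarrow> s) at_top"
proof -
  have "((\<lambda>L. s * (sqrt ((grid_a s L / L)\<^sup>2 + 1) - grid_a s L / L)) \<longlongrightarrow> s * (sqrt (0\<^sup>2 + 1) - 0)) at_top"
    by (intro tendsto_intros grid_a_limit assms)
  moreover have "\<forall>\<^sub>F L in at_top. s * (sqrt ((grid_a s L / L)\<^sup>2 + 1) - grid_a s L / L) = grid_nu s L / L"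
    using eventually_gt_at_top[of 0]
  proof eventually_elim
    case (elim L)
    have "(grid_a s L)\<^sup>2 + L\<^sup>2 = ((grid_a s L / L)\<^sup>2 + 1) * L\<^sup>2"
      using elim by (simp add: field_simps)
    then have "sqrt ((grid_a s L)\<^sup>2 + L\<^sup>2) = sqrt ((grid_a s L / L)\<^sup>2 + 1) * L"
      using elim by (simp add: real_sqrt_mult)
    then show ?case using elim by (simp add: grid_nu_def field_simps)
  qed
  ultimately show ?thesis by (auto elim: Lim_transform_eventually)
qed

lemma near_origin_bound_limit:
  "((\<lambda>L. (\<kappa> * L\<^sup>2 + c) / L\<^sup>2) \<longlongrightarrow> \<kappa>) at_top" for \<kappa> c :: real
  by real_asymp

text \<open>
  The buffer \<open>a\<close> above the threshold is chosen such that \<open>exp (- a\<^sup>2 / 2) = 1 / \<lambda>\<^sub>f\<close>, which turns a loss of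
  order \<open>L\<^sup>2\<close> into one of order \<open>L\<close>.
\<close>

lemma far_bound_limit:
  assumes "0 < s" "0 < r"
  shows "((\<lambda>L. (L\<^sup>2 / r * exp (- (grid_a s L)\<^sup>2 / 2) + c) / L\<^sup>2) \<longlongrightarrow> 0) at_top"
proof -
  have "((\<lambda>L. (L\<^sup>2 / r * (1 / (s * L)) + c) / L\<^sup>2) \<longlongrightarrow> 0) at_top"
    using assms by real_asymp
  moreover have "\<forall>\<^sub>F L in at_top. (L\<^sup>2 / r * (1 / (s * L)) + c) / L\<^sup>2
      = (L\<^sup>2 / r * exp (- (grid_a s L)\<^sup>2 / 2) + c) / L\<^sup>2"
    using eventually_ge_at_top[of "1 / s"]
  proof eventually_elim
    case (elim L)
    then have "1 \<le> s * L" using assms by (simp add: field_simps)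
    then have "exp (- (grid_a s L)\<^sup>2 / 2) = 1 / (s * L)"
      by (simp add: grid_a_def exp_minus field_simps)
    then show ?case by simp
  qed
  ultimately show ?thesis by (rule Lim_transform_eventually)
qed

text \<open>
  Since \<open>\<nu> / L \<rightarrow> s\<close>, \<open>a / L \<rightarrow> 0\<close> and the logarithm stays bounded, only the first summand survives. Its limit
  \<open>(1 - v\<^sub>w) / 2 = 1 / (2 (1 + r))\<close> agrees with the constant \<open>v\<^sub>w / (2 r)\<close> from the parameters below \<open>\<nu>\<close>; this
  balance determines \<open>\<nu>\<close>.
\<close>

lemma cluster_bound_limit:
  assumes s: "0 < s" "s \<le> 1" and r: "0 < r"
  shows "((\<lambda>L. ((L\<^sup>2 - (grid_nu s L)\<^sup>2) / 2
      + ln (4 * (1 + ((L + grid_a s L) / grid_nu s L - 1) / (2 * r)))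
      + (L + grid_a s L) + c) / L\<^sup>2) \<longlongrightarrow> (1 - s\<^sup>2) / 2) at_top"
    (is "((\<lambda>L. ?f L / L\<^sup>2) \<longlongrightarrow> _) _")
proof -
  let ?a = "\<lambda>L. grid_a s L / L" and ?n = "\<lambda>L. grid_nu s L / L"
  note lim = grid_a_limit[OF s(1)] grid_nu_limit[OF s(1)]
  define D where "D L = ln (4 * (1 + ((1 + ?a L) / ?n L - 1) / (2 * r)))" for L
  have inv: "((\<lambda>L::real. inverse L) \<longlongrightarrow> 0) at_top" by real_asymp
  have "((\<lambda>L. (1 + ?a L) / ?n L) \<longlongrightarrow> (1 + 0) / s) at_top"
    using s by (intro tendsto_intros lim) auto
  then have lim': "((\<lambda>L. (1 + ?a L) / ?n L) \<longlongrightarrow> 1 / s) at_top" by simp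
  have "1 \<le> 1 / s" using s by simp
  then have D0: "0 < 4 * (1 + (1 / s - 1) / (2 * r))" using r by (simp add: add_pos_nonneg)
  have D: "(D \<longlongrightarrow> ln (4 * (1 + (1 / s - 1) / (2 * r)))) at_top"
    unfolding D_def[abs_def] using D0 r by (intro tendsto_intros lim') auto
  have "((\<lambda>L. (1 - (?n L)\<^sup>2) / 2 + D L * (inverse L)\<^sup>2 + (1 + ?a L) * inverse L + c * (inverse L)\<^sup>2)
      \<longlongrightarrow> (1 - s\<^sup>2) / 2 + ln (4 * (1 + (1 / s - 1) / (2 * r))) * 0\<^sup>2 + (1 + 0) * 0 + c * 0\<^sup>2) at_top"
    by (intro tendsto_intros lim D inv) auto
  moreover have "\<forall>\<^sub>F L in at_top. (1 - (?n L)\<^sup>2) / 2 + D L * (inverse L)\<^sup>2 + (1 + ?a L) * inverse L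
      + c * (inverse L)\<^sup>2 = ?f L / L\<^sup>2"
    using eventually_gt_at_top[of 0]
  proof eventually_elim
    case (elim L)
    have "1 + ?a L = (L + grid_a s L) / L" using elim by (simp add: field_simps)
    then have "(L + grid_a s L) / grid_nu s L = (1 + ?a L) / ?n L" using elim by simp
    then have "D L = ln (4 * (1 + ((L + grid_a s L) / grid_nu s L - 1) / (2 * r)))"
      by (simp only: D_def)
    then show ?case using elim by (simp add: field_simps power2_eq_square)
  qed
  ultimately show ?thesis by (auto elim: Lim_transform_eventually)
qed


lemma eventually_div_square_bounds:
  fixes f :: "real \<Rightarrow> real"
  assumes "((\<lambda>L. f L / L\<^sup>2) \<longlongrightarrow> l) at_top" "l \<le> \<kappa>" "0 < e"
  shows "\<forall>\<^sub>F L in at_top. f L \<le> (\<kappa> + e) * L\<^sup>2"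
proof -
  have "\<forall>\<^sub>F L in at_top. f L / L\<^sup>2 < \<kappa> + e"
    using assms by (intro order_tendstoD(2)[OF assms(1)]) simp
  then show ?thesis using eventually_gt_at_top[of 0]
    by eventually_elim (simp add: pos_divide_less_eq less_imp_le)
qed

lemma lambda_e_at_top: "filterlim lambda_e at_top (at_right 0)"
  unfolding lambda_e_def[abs_def] by real_asymp

lemma lambda_e_facts:
  assumes "0 < \<eta>" "\<eta> < 1 / 2"
  shows "0 < lambda_e \<eta>" "exp ((lambda_e \<eta>)\<^sup>2 / 2) = (1 - \<eta>) / \<eta>"
    "ln (\<eta> / (1 - \<eta>)) = - ((lambda_e \<eta>)\<^sup>2 / 2)"
proof -
  have "1 < (1 - \<eta>) / \<eta>" using assms by (simp add: field_simps)
  moreover have eq: "inverse \<eta> * (1 - \<eta>) = (1 - \<eta>) / \<eta>" by (simp add: field_simps)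
  ultimately have sq: "(lambda_e \<eta>)\<^sup>2 = 2 * ln ((1 - \<eta>) / \<eta>)" and ln0: "0 < ln ((1 - \<eta>) / \<eta>)"
    by (simp_all add: lambda_e_def)
  show "0 < lambda_e \<eta>" unfolding lambda_e_def eq using ln0 by simp
  show "exp ((lambda_e \<eta>)\<^sup>2 / 2) = (1 - \<eta>) / \<eta>" unfolding sq using assms by simp
  show "ln (\<eta> / (1 - \<eta>)) = - ((lambda_e \<eta>)\<^sup>2 / 2)" unfolding sq using ln_inverse[of "(1 - \<eta>) / \<eta>"] by simp
qed

lemma v_w_facts:
  assumes "0 < r"
  shows "0 < v_w r" "v_w r \<le> 1" "v_w r / r = 1 / (1 + r)" "1 - v_w r = 1 / (1 + r)"
    "v_w r * (1 + 1 / r) = 1"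
proof -
  have "0 < r + r * r" using assms by (intro add_pos_pos mult_pos_pos)
  moreover have "1 + inverse r = (1 + r) / r" using assms by (simp add: field_simps)
  ultimately have v: "v_w r = r / (1 + r)" "r + r * r \<noteq> 0" by (simp_all add: v_w_def)
  show "0 < v_w r" "v_w r \<le> 1" using assms by (simp_all add: v(1))
  show "v_w r / r = 1 / (1 + r)" "1 - v_w r = 1 / (1 + r)"
    "v_w r * (1 + 1 / r) = 1"
    using assms v by (simp_all add: field_simps)
qed

lemma lambda_f_sq: "0 < r \<Longrightarrow> (lambda_f r \<eta>)\<^sup>2 = v_w r * (lambda_e \<eta>)\<^sup>2"
  using v_w_facts(1)[of r] by (simp add: lambda_f_def power_mult_distrib)

definition minimax_rate :: "real \<Rightarrow> real \<Rightarrow> real" where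
  "minimax_rate r \<eta> = 1 / (2 * r) * \<eta> * (lambda_f r \<eta>)\<^sup>2"

lemma minimax_rate_eq: "0 < r \<Longrightarrow> minimax_rate r \<eta> = \<eta> * (1 / (2 * (1 + r)) * (lambda_e \<eta>)\<^sup>2)"
proof -
  assume r: "0 < r"
  have "minimax_rate r \<eta> = \<eta> * (v_w r / r * (1 / 2) * (lambda_e \<eta>)\<^sup>2)"
    by (simp add: minimax_rate_def lambda_f_sq[OF r])
  then show ?thesis by (simp add: v_w_facts(3)[OF r] mult.commute)
qed

lemma bayes_risk_two_point_asymp_ge:
  assumes r: "0 < r" and e: "0 < e"
  shows "\<forall>\<^sub>F \<eta> in at_right 0.
    ereal ((1 - e) * minimax_rate r \<eta>) \<le> bayes_risk r (two_point_prior \<eta> (lambda_f r \<eta>))"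
proof -
  let ?\<kappa> = "1 / (2 * (1 + r))" and ?s = "sqrt (v_w r)"
  have s: "0 < ?s" "?s\<^sup>2 = v_w r" using v_w_facts(1)[OF r] by auto
  let ?c = "3 / 2 * ?s + ?s / (2 * r)"
  have "((\<lambda>L. (ln 2 + ?c * L) / L\<^sup>2) \<longlongrightarrow> 0) at_top" for c :: real
    by real_asymp
  from eventually_div_square_bounds[OF this, of 0 "e * ?\<kappa>"]
  have "\<forall>\<^sub>F L in at_top. ln 2 + ?c * L \<le> e * ?\<kappa> * L\<^sup>2" using r e by simp
  then have "\<forall>\<^sub>F \<eta> in at_right 0. ln 2 + ?c * lambda_e \<eta> \<le> e * ?\<kappa> * (lambda_e \<eta>)\<^sup>2"
    by (rule eventually_compose_filterlim[OF _ lambda_e_at_top])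
  moreover have "\<forall>\<^sub>F \<eta> in at_right 0. \<eta> \<in> {0<..<1 / 2 :: real}"
    by (rule eventually_at_right_real) simp
  ultimately show ?thesis
  proof eventually_elim
    case (elim \<eta>)
    then have \<eta>: "0 < \<eta>" "\<eta> < 1 / 2" by auto
    let ?L = "lambda_e \<eta>" and ?t = "lambda_f r \<eta>"
    have t: "0 < ?t" "?t = ?s * ?L" using lambda_e_facts[OF \<eta>] s by (auto simp: lambda_f_def)
    have t2: "?t\<^sup>2 / (2 * r) = ?\<kappa> * ?L\<^sup>2"
    proof -
      have "?t\<^sup>2 / (2 * r) = v_w r / r * (1 / 2) * ?L\<^sup>2" by (simp add: lambda_f_sq[OF r])
      then show ?thesis by (simp add: v_w_facts(3)[OF r] mult.commute)
    qed
    have crit: "ln (\<eta> / (1 - \<eta>)) = - (?t\<^sup>2 / 2) * (1 + 1 / r)"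
    proof -
      have "- (?t\<^sup>2 / 2) * (1 + 1 / r) = - (?L\<^sup>2 / 2) * (v_w r * (1 + 1 / r))"
        by (simp add: lambda_f_sq[OF r])
      then show ?thesis using v_w_facts(5)[OF r] lambda_e_facts(3)[OF \<eta>] by simp
    qed
    have "(1 - e) * minimax_rate r \<eta> = \<eta> * (?\<kappa> * ?L\<^sup>2 - e * ?\<kappa> * ?L\<^sup>2)"
    proof -
      have "(1 - e) * (\<eta> * (k * X)) = \<eta> * (k * X - e * k * X)" for k X by (simp add: algebra_simps)
      then show ?thesis by (simp only: minimax_rate_eq[OF r])
    qed
    also have "\<dots> \<le> \<eta> * (?\<kappa> * ?L\<^sup>2 - (ln 2 + ?c * ?L))"
      using elim \<eta> by (intro mult_left_mono) auto
    also have "?\<kappa> * ?L\<^sup>2 - (ln 2 + ?c * ?L) = ?t\<^sup>2 / (2 * r) - ln 2 - 3 / 2 * ?t - ?t / (2 * r)"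
      unfolding t2 using t(2) by (simp add: algebra_simps)
    finally have "ereal ((1 - e) * minimax_rate r \<eta>)
        \<le> ereal (\<eta> * (?t\<^sup>2 / (2 * r) - ln 2 - 3 / 2 * ?t - ?t / (2 * r)))" by simp
    also have "\<dots> \<le> bayes_risk r (two_point_prior \<eta> ?t)"
      using bayes_risk_two_point_ge[OF r t(1) \<eta>(1) _ crit] \<eta> by simp
    finally show ?case .
  qed
qed


lemma p_TCL_asymp_minimax:
  assumes r: "0 < r" and e: "0 < e"
  shows "\<forall>\<^sub>F \<eta> in at_right 0. p_TCL r \<eta> \<in> pred_estimators \<and>
    (SUP \<pi>\<in>sparse_priors \<eta>. int_risk r \<pi> (p_TCL r \<eta>)) \<le> ereal ((1 + e) * minimax_rate r \<eta>)"
proof -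
  let ?\<kappa> = "1 / (2 * (1 + r))" and ?s = "sqrt (v_w r)"
  have v: "0 < v_w r" "v_w r \<le> 1" using v_w_facts[OF r] by auto
  have s: "0 < ?s" "?s \<le> 1" "?s\<^sup>2 = v_w r" using v by auto
  have \<kappa>: "0 < ?\<kappa>" "(1 - ?s\<^sup>2) / 2 = ?\<kappa>" using r v_w_facts(4)[OF r] s(3) by auto
  define c where "c = p_U_risk_bound r"
  \<comment> \<open>The four bounds are those near the origin, around the cluster points, beyond them, and at the origin
    itself, the last one after division by \<open>\<eta>\<close>. The first three may grow like \<open>\<kappa> L\<^sup>2\<close>, the last one must be
    \<open>o(L\<^sup>2)\<close>.\<close>
  define B1 where "B1 L = ?\<kappa> * L\<^sup>2 + (ln 2 + c)" for L :: real
  define B2 where "B2 L = (L\<^sup>2 - (grid_nu ?s L)\<^sup>2) / 2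
      + ln (4 * (1 + ((L + grid_a ?s L) / grid_nu ?s L - 1) / (2 * r)))
      + (L + grid_a ?s L) + c" for L :: real
  define B3 where "B3 L = L\<^sup>2 / r * exp (- (grid_a ?s L)\<^sup>2 / 2) + (1 / r + ln 2 + c)" for L :: real
  define E where "E = 2 * (ln (1 + 1 / r) / 2 + 1 / (1 + r))"
  define B0 where "B0 L = 2 * (1 + E * L)" for L :: real
  \<comment> \<open>Half of the relative error \<open>e\<close> is spent on the nonzero parameters, half on the origin.\<close>
  define d where "d = e * ?\<kappa> / 2"
  have d: "0 < d" using e \<kappa> by (simp add: d_def)
  have E: "0 \<le> E" using r by (simp add: E_def)
  have B1: "\<forall>\<^sub>F L in at_top. B1 L \<le> (?\<kappa> + d) * L\<^sup>2"
    unfolding B1_def by (rule eventually_div_square_bounds[OF near_origin_bound_limit order_refl d])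
  have B2: "\<forall>\<^sub>F L in at_top. B2 L \<le> (?\<kappa> + d) * L\<^sup>2"
    unfolding B2_def
    by (rule eventually_div_square_bounds[OF cluster_bound_limit[OF s(1,2) r] _ d]) (simp add: \<kappa>(2))
  have B3: "\<forall>\<^sub>F L in at_top. B3 L \<le> (?\<kappa> + d) * L\<^sup>2"
    unfolding B3_def
    by (rule eventually_div_square_bounds[OF far_bound_limit[OF s(1) r] _ d]) (use \<kappa> in auto)
  have "((\<lambda>L. B0 L / L\<^sup>2) \<longlongrightarrow> 0) at_top" unfolding B0_def by real_asymp
  from eventually_div_square_bounds[OF this order_refl d]
  have B0: "\<forall>\<^sub>F L in at_top. B0 L \<le> d * L\<^sup>2" by simp
  \<comment> \<open>\<open>L \<ge> 1 / s\<close> makes \<open>\<lambda>\<^sub>f \<ge> 1\<close>, so that \<open>a\<close> is the root of a nonnegative number.\<close>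
  have large: "\<forall>\<^sub>F L in at_top. max 2 (1 / ?s) \<le> L" by (rule eventually_ge_at_top)
  have "\<forall>\<^sub>F L in at_top. B1 L \<le> (?\<kappa> + d) * L\<^sup>2 \<and> B2 L \<le> (?\<kappa> + d) * L\<^sup>2
      \<and> B3 L \<le> (?\<kappa> + d) * L\<^sup>2 \<and> B0 L \<le> d * L\<^sup>2 \<and> max 2 (1 / ?s) \<le> L"
    by (intro eventually_conj B1 B2 B3 B0 large)
  from eventually_compose_filterlim[OF this lambda_e_at_top]
  have "\<forall>\<^sub>F \<eta> in at_right 0. B1 (lambda_e \<eta>) \<le> (?\<kappa> + d) * (lambda_e \<eta>)\<^sup>2
      \<and> B2 (lambda_e \<eta>) \<le> (?\<kappa> + d) * (lambda_e \<eta>)\<^sup>2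
      \<and> B3 (lambda_e \<eta>) \<le> (?\<kappa> + d) * (lambda_e \<eta>)\<^sup>2 \<and> B0 (lambda_e \<eta>) \<le> d * (lambda_e \<eta>)\<^sup>2
      \<and> max 2 (1 / ?s) \<le> lambda_e \<eta>" .
  moreover have "\<forall>\<^sub>F \<eta> in at_right 0. \<eta> \<in> {0<..<1 / 2 :: real}"
    by (rule eventually_at_right_real) simp
  ultimately show ?thesis
  proof eventually_elim
    case (elim \<eta>)
    define L where "L = lambda_e \<eta>"
    have \<eta>: "0 < \<eta>" "\<eta> < 1 / 2" using elim by auto
    have L: "2 \<le> L" "1 / ?s \<le> L" using elim by (auto simp: L_def)
    have B: "B1 L \<le> (?\<kappa> + d) * L\<^sup>2" "B2 L \<le> (?\<kappa> + d) * L\<^sup>2" "B3 L \<le> (?\<kappa> + d) * L\<^sup>2"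
      "B0 L \<le> d * L\<^sup>2" using elim by (auto simp: L_def)
    define a where "a = grid_a ?s L"
    define \<nu> where "\<nu> = grid_nu ?s L"
    have "1 \<le> ?s * L" using L(2) s(1) by (simp add: field_simps)
    then have a0: "0 \<le> a" by (simp add: a_def grid_a_def)
    have a: "cl_a r \<eta> = a" by (simp add: cl_a_def a_def grid_a_def lambda_f_def L_def)
    define m where "m = sqrt (a\<^sup>2 + L\<^sup>2) - a"
    have m: "0 < m" "m \<le> L"
    proof -
      show "0 < m" using L a0 real_sqrt_less_mono[of "a\<^sup>2" "a\<^sup>2 + L\<^sup>2"] by (simp add: m_def)
      have "sqrt (a\<^sup>2 + L\<^sup>2) \<le> sqrt ((a + L)\<^sup>2)"
        using a0 L by (intro real_sqrt_le_mono) (simp add: power2_sum)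
      then show "m \<le> L" using a0 L by (simp add: m_def)
    qed
    have \<nu>_m: "\<nu> = ?s * m" by (simp add: \<nu>_def grid_nu_def m_def a_def)
    have \<nu>: "cl_nu r \<eta> = \<nu>"
      using cl_mu_eq[of \<eta> r] L unfolding \<nu>_m cl_nu_def m_def a L_def by simp
    have \<nu>pos: "0 < \<nu>" using m s by (simp add: \<nu>_m)
    have \<nu>sL: "\<nu> \<le> ?s * L" using m s by (simp add: \<nu>_m)
    have \<nu>L: "\<nu> \<le> L"
    proof -
      have "?s * L \<le> 1 * L" using s(2) L(1) by (intro mult_right_mono) auto
      then show ?thesis using \<nu>sL by linarith
    qed
    then have \<nu>T: "\<nu> \<le> L + a" using a0 by simp
    define K where "K = cl_K r \<eta>"
    have q: "1 < 1 + 2 * r" using r by simp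
    have Kmax: "K = Max {k. 1 \<le> k \<and> (1 + 2 * r) ^ (k - 1) * \<nu> \<le> L + a}"
      by (simp add: K_def cl_K_def cl_point_def \<nu> a L_def)
    note grid = geometric_grid[OF q \<nu>pos \<nu>T, folded Kmax]
    let ?\<mu> = "cl_point r \<eta>"
    have \<mu>: "?\<mu> k = (1 + 2 * r) ^ (k - 1) * \<nu>" for k by (simp add: cl_point_def \<nu>)
    have L2: "2 \<le> L\<^sup>2"
    proof -
      have "2\<^sup>2 \<le> L\<^sup>2" using L(1) by (intro power_mono) auto
      then show ?thesis by simp
    qed
    have odds: "\<eta> / (1 - \<eta>) \<le> \<eta> * 2" using \<eta> by (simp add: field_simps)
    interpret cluster_threshold r \<eta> L K ?\<mu>
      using r \<eta> grid(1) L lambda_e_facts(2)[OF \<eta>] by unfold_locales (auto simp: L_def)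
    have est: "p_TCL r \<eta> = est" by (rule p_TCL_eq_est) (simp_all add: L_def K_def)
    define R where "R = (?\<kappa> + d) * L\<^sup>2"
    have R0: "0 \<le> R" using \<kappa> d by (simp add: R_def)
    have risk: "nn_risk r \<theta> est \<le> ennreal R" for \<theta>
    proof -
      consider "\<bar>\<theta>\<bar> \<le> \<nu>" | "\<nu> \<le> \<bar>\<theta>\<bar>" "\<bar>\<theta>\<bar> \<le> L + a" | "L + a \<le> \<bar>\<theta>\<bar>" by linarith
      then show ?thesis
      proof cases
        case 1
        have "\<nu>\<^sup>2 \<le> (?s * L)\<^sup>2" using \<nu>sL \<nu>pos by (intro power_mono) auto
        then have "\<nu>\<^sup>2 / (2 * r) \<le> v_w r * L\<^sup>2 / (2 * r)"
          using r s(3) by (intro divide_right_mono) (auto simp: power_mult_distrib)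
        also have "\<dots> = v_w r / r * (1 / 2) * L\<^sup>2" by simp
        also have "\<dots> = ?\<kappa> * L\<^sup>2" by (simp add: v_w_facts(3)[OF r] mult.commute)
        finally have "\<nu>\<^sup>2 / (2 * r) + ln 2 + p_U_risk_bound r \<le> R"
          using B(1) by (simp add: B1_def c_def R_def)
        then show ?thesis
          by (intro order_trans[OF nn_risk_le_near_origin[OF 1] ennreal_leI])
      next
        case 2
        from grid(4)[OF 2] obtain k where k: "k \<in> {1..K}" "?\<mu> k \<le> \<bar>\<theta>\<bar>" "\<bar>\<theta>\<bar> \<le> (1 + 2 * r) * ?\<mu> k"
          unfolding \<mu> by blast
        have "1 \<le> (1 + 2 * r) ^ (k - 1)" using r by (intro one_le_power) simp
        then have \<nu>k: "\<nu> \<le> ?\<mu> k" using \<nu>pos by (simp add: \<mu>)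
        have kT: "?\<mu> k \<le> L + a" using grid(3)[OF k(1)] by (simp add: \<mu>)
        define N where "N = 1 + ((L + a) / \<nu> - 1) / (2 * r)"
        have "real K \<le> N" using grid(2) by (simp add: N_def)
        then have "ln (4 * real K) \<le> ln (4 * N)"
          using grid(1) by (subst ln_le_cancel_iff) auto
        then have "(L\<^sup>2 - \<nu>\<^sup>2) / 2 + ln (4 * real K) + ?\<mu> k + p_U_risk_bound r \<le> R"
          using B(2) kT unfolding B2_def R_def c_def a_def[symmetric] \<nu>_def[symmetric] N_def[symmetric]
          by linarith
        then show ?thesis
          using nn_risk_le_cluster_point[OF k(1) less_imp_le[OF \<nu>pos] \<nu>k \<nu>L k(2,3)]
          by (elim order_trans) (rule ennreal_leI)
      next
        case 3
        have "L\<^sup>2 / r * exp (- a\<^sup>2 / 2) + 1 / r + ln 2 + p_U_risk_bound r \<le> R"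
          using B(3) by (simp add: B3_def c_def R_def a_def add_ac)
        then show ?thesis
          by (intro order_trans[OF nn_risk_le_far[OF a0 3] ennreal_leI])
      qed
    qed
    have risk0: "nn_risk r 0 est \<le> ennreal (\<eta> * (d * L\<^sup>2))"
    proof (rule order_trans[OF nn_risk_origin_le[OF L2] ennreal_leI])
      have "\<eta> / (1 - \<eta>) * (1 + E * L) \<le> \<eta> * 2 * (1 + E * L)"
        using odds E L by (intro mult_right_mono) auto
      also have "\<dots> = \<eta> * B0 L" by (simp add: B0_def)
      also have "\<dots> \<le> \<eta> * (d * L\<^sup>2)" using B(4) \<eta> by (intro mult_left_mono) auto
      finally show "\<eta> / (1 - \<eta>) * (1 + 2 * (ln (1 + 1 / r) / 2 + 1 / (1 + r)) * L) \<le> \<eta> * (d * L\<^sup>2)"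
        by (simp only: E_def)
    qed
    have "int_risk r \<pi> est \<le> ereal (\<eta> * R + \<eta> * (d * L\<^sup>2))" if "\<pi> \<in> sparse_priors \<eta>" for \<pi>
      using \<eta> d by (intro int_risk_sparse_le[OF r est_estimator that R0 risk _ risk0]) auto
    moreover have "\<eta> * R + \<eta> * (d * L\<^sup>2) = (1 + e) * minimax_rate r \<eta>"
    proof -
      have "\<eta> * ((k + e * k / 2) * X) + \<eta> * (e * k / 2 * X) = (1 + e) * (\<eta> * (k * X))" for k X
        by (simp add: algebra_simps)
      then show ?thesis by (simp only: R_def d_def minimax_rate_eq[OF r] L_def)
    qed
    ultimately show ?case
      using est_estimator unfolding est by (auto intro: SUP_least)
  qed
qed

text \<open>
  Both functions need only be squeezed around a common positive rate: squeezing forces finiteness, and the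
  ratio of two functions with ratio \<open>1\<close> to the rate tends to \<open>1\<close>.
\<close>

lemma asymp_eq_at_0I:
  fixes f g :: "real \<Rightarrow> ereal" and G :: "real \<Rightarrow> real"
  assumes pos: "\<forall>\<^sub>F \<eta> in at_right 0. 0 < G \<eta>"
    and f: "\<And>e. 0 < e \<Longrightarrow> \<forall>\<^sub>F \<eta> in at_right 0. ereal ((1 - e) * G \<eta>) \<le> f \<eta> \<and> f \<eta> \<le> ereal ((1 + e) * G \<eta>)"
    and g: "\<And>e. 0 < e \<Longrightarrow> \<forall>\<^sub>F \<eta> in at_right 0. ereal ((1 - e) * G \<eta>) \<le> g \<eta> \<and> g \<eta> \<le> ereal ((1 + e) * G \<eta>)"
  shows "asymp_eq_at_0 f g"
proof -
  let ?F = "at_right (0::real)"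
  have real_part: "\<forall>\<^sub>F \<eta> in ?F. h \<eta> = ereal (real_of_ereal (h \<eta>))"
    and ratio: "((\<lambda>\<eta>. real_of_ereal (h \<eta>) / G \<eta>) \<longlongrightarrow> 1) ?F"
    if h: "\<And>e. 0 < e \<Longrightarrow> \<forall>\<^sub>F \<eta> in ?F. ereal ((1 - e) * G \<eta>) \<le> h \<eta> \<and> h \<eta> \<le> ereal ((1 + e) * G \<eta>)"
    for h :: "real \<Rightarrow> ereal"
  proof -
    show re: "\<forall>\<^sub>F \<eta> in ?F. h \<eta> = ereal (real_of_ereal (h \<eta>))"
      using h[OF zero_less_one]
    proof eventually_elim
      case (elim \<eta>)
      then show ?case by (cases "h \<eta>") auto
    qed
    show "((\<lambda>\<eta>. real_of_ereal (h \<eta>) / G \<eta>) \<longlongrightarrow> 1) ?F"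
    proof (rule tendstoI)
      fix e :: real assume e: "0 < e"
      from h[of "e / 2"] e
      have "\<forall>\<^sub>F \<eta> in ?F. ereal ((1 - e / 2) * G \<eta>) \<le> h \<eta> \<and> h \<eta> \<le> ereal ((1 + e / 2) * G \<eta>)" by simp
      with re pos show "\<forall>\<^sub>F \<eta> in ?F. dist (real_of_ereal (h \<eta>) / G \<eta>) 1 < e"
      proof eventually_elim
        case (elim \<eta>)
        define x where "x = real_of_ereal (h \<eta>)"
        have "(1 - e / 2) * G \<eta> \<le> x" "x \<le> (1 + e / 2) * G \<eta>"
          using elim(1,3) by (metis x_def ereal_less_eq(3))+
        then have "1 - e / 2 \<le> x / G \<eta>" "x / G \<eta> \<le> 1 + e / 2"
          using elim(2) by (simp_all add: pos_le_divide_eq pos_divide_le_eq)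
        then show ?case using e unfolding x_def[symmetric] by (simp add: dist_real_def abs_if)
      qed
    qed
  qed
  let ?f = "\<lambda>\<eta>. real_of_ereal (f \<eta>)" and ?g = "\<lambda>\<eta>. real_of_ereal (g \<eta>)"
  have "((\<lambda>\<eta>. (?f \<eta> / G \<eta>) / (?g \<eta> / G \<eta>) - 1) \<longlongrightarrow> 1 / 1 - 1) ?F"
    by (intro tendsto_intros ratio f g) auto
  then have "(\<lambda>\<eta>. (?f \<eta> / G \<eta>) / (?g \<eta> / G \<eta>) - 1) \<in> o[?F](\<lambda>_. 1)"
    by (intro smalloI_tendsto) auto
  moreover have "\<forall>\<^sub>F \<eta> in ?F. f \<eta> = g \<eta> * ereal (1 + ((?f \<eta> / G \<eta>) / (?g \<eta> / G \<eta>) - 1))"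
  proof -
    have "\<forall>\<^sub>F \<eta> in ?F. f \<eta> = ereal (?f \<eta>)" by (rule real_part) (rule f)
    moreover have "\<forall>\<^sub>F \<eta> in ?F. g \<eta> = ereal (?g \<eta>)" by (rule real_part) (rule g)
    moreover have "\<forall>\<^sub>F \<eta> in ?F. 0 < ?g \<eta> / G \<eta>"
      using order_tendstoD(1)[OF ratio[OF g], of 0] by simp
    ultimately show ?thesis using pos
    proof eventually_elim
      case (elim \<eta>)
      define x y where "x = ?f \<eta>" and "y = ?g \<eta>"
      have "y \<noteq> 0" using elim(3) by (auto simp: y_def)
      then have "x = y * (1 + ((x / G \<eta>) / (y / G \<eta>) - 1))" using elim(4) by simp
      moreover have "f \<eta> = ereal x" "g \<eta> = ereal y" using elim(1,2) by (simp_all only: x_def y_def)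
      ultimately show ?case unfolding x_def[symmetric] y_def[symmetric] by simp
    qed
  qed
  ultimately show ?thesis unfolding asymp_eq_at_0_def by blast
qed

theorem theorem2:
  fixes r :: real
  assumes "0 < r"
  shows
    "asymp_eq_at_0 (\<lambda>\<eta>. minimax_risk \<eta> r)
                   (\<lambda>\<eta>. ereal (1 / (2 * r) * \<eta> * (lambda_f r \<eta>)\<^sup>2))
     \<and> (\<forall>\<eta>. 0 < \<eta> \<and> \<eta> < 1 / 2 \<longrightarrow> two_point_prior \<eta> (lambda_f r \<eta>) \<in> sparse_priors \<eta>)
     \<and> asymp_eq_at_0 (\<lambda>\<eta>. bayes_risk r (two_point_prior \<eta> (lambda_f r \<eta>)))
                     (\<lambda>\<eta>. minimax_risk \<eta> r)
     \<and> (\<forall>\<^sub>F \<eta> in at_right 0. p_TCL r \<eta> \<in> pred_estimators)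
     \<and> asymp_eq_at_0 (\<lambda>\<eta>. SUP \<pi>\<in>sparse_priors \<eta>. int_risk r \<pi> (p_TCL r \<eta>))
                     (\<lambda>\<eta>. minimax_risk \<eta> r)"
proof -
  let ?G = "minimax_rate r" and ?m = "\<lambda>\<eta>. minimax_risk \<eta> r"
  let ?b = "\<lambda>\<eta>. bayes_risk r (two_point_prior \<eta> (lambda_f r \<eta>))"
  let ?s = "\<lambda>\<eta>. SUP \<pi>\<in>sparse_priors \<eta>. int_risk r \<pi> (p_TCL r \<eta>)"
  have small: "\<forall>\<^sub>F \<eta> in at_right 0. \<eta> \<in> {0<..<1 / 2 :: real}"
    by (rule eventually_at_right_real) simp
  have est: "\<forall>\<^sub>F \<eta> in at_right 0. p_TCL r \<eta> \<in> pred_estimators"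
    using p_TCL_asymp_minimax[OF assms zero_less_one] by (rule eventually_mono) simp
  have sparse: "two_point_prior \<eta> (lambda_f r \<eta>) \<in> sparse_priors \<eta>" if "0 < \<eta>" "\<eta> < 1 / 2" for \<eta>
    using that by (intro two_point_prior_sparse) auto
  have pos: "\<forall>\<^sub>F \<eta> in at_right 0. 0 < ?G \<eta>"
    using small
  proof eventually_elim
    case (elim \<eta>)
    then show ?case using assms lambda_e_facts(1)[of \<eta>]
      by (auto simp: minimax_rate_eq intro!: mult_pos_pos divide_pos_pos)
  qed
  have chain: "\<forall>\<^sub>F \<eta> in at_right 0. ereal ((1 - e) * ?G \<eta>) \<le> ?b \<eta> \<and> ?b \<eta> \<le> ?m \<eta> \<and> ?m \<eta> \<le> ?s \<eta>
      \<and> ?s \<eta> \<le> ereal ((1 + e) * ?G \<eta>)" if e: "0 < e" for e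
    using bayes_risk_two_point_asymp_ge[OF assms e] p_TCL_asymp_minimax[OF assms e] small
  proof eventually_elim
    case (elim \<eta>)
    have "?b \<eta> \<le> ?m \<eta>"
      unfolding bayes_risk_def minimax_risk_def
      using sparse[of \<eta>] elim(3) by (intro INF_mono) (auto intro: SUP_upper)
    moreover have "?m \<eta> \<le> ?s \<eta>"
      unfolding minimax_risk_def using elim(2) by (intro INF_lower) auto
    ultimately show ?case using elim by auto
  qed
  have b: "\<forall>\<^sub>F \<eta> in at_right 0. ereal ((1 - e) * ?G \<eta>) \<le> ?b \<eta> \<and> ?b \<eta> \<le> ereal ((1 + e) * ?G \<eta>)"
    and m: "\<forall>\<^sub>F \<eta> in at_right 0. ereal ((1 - e) * ?G \<eta>) \<le> ?m \<eta> \<and> ?m \<eta> \<le> ereal ((1 + e) * ?G \<eta>)"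
    and s: "\<forall>\<^sub>F \<eta> in at_right 0. ereal ((1 - e) * ?G \<eta>) \<le> ?s \<eta> \<and> ?s \<eta> \<le> ereal ((1 + e) * ?G \<eta>)"
    if "0 < e" for e
    by (rule eventually_mono[OF chain[OF that]]; blast intro: order_trans)+
  have G: "\<forall>\<^sub>F \<eta> in at_right 0. ereal ((1 - e) * ?G \<eta>) \<le> ereal (?G \<eta>)
      \<and> ereal (?G \<eta>) \<le> ereal ((1 + e) * ?G \<eta>)" if "0 < e" for e
    using pos by eventually_elim (use that in \<open>auto simp: algebra_simps\<close>)
  have "asymp_eq_at_0 ?m (\<lambda>\<eta>. ereal (?G \<eta>))" "asymp_eq_at_0 ?b ?m" "asymp_eq_at_0 ?s ?m"
    by (rule asymp_eq_at_0I[OF pos]; fact m b s G)+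
  then show ?thesis using sparse est by (auto simp: minimax_rate_def)
qed

end
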